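(* There is a (randomized) $\tilde{O}(n^{2/3})$-approximation algorithm for Constrained Connectivity-Sum on $K_n$ that runs in time $\tilde{O}(n^6)$.
   Context: Constrained Connectivity: given a graph $G=(V,E)$, $n=|V|$, and for each ordered pair $(u,v)\in V\times V$ a set $S(u,v)\subseteq V$ (the safe set) with $u,v\in S(u,v)$. A subgraph $H=(V,F)$ of $G$ is safely connected if for every ordered pair $(u,v)$ there is a $u$–$v$ path in $H$ all of whose vertices lie in $S(u,v)$. Constrained Connectivity-Sum asks for a safely connected subgraph minimizing $|F|$. "On $K_n$" means $G$ is the complete graph on $V$. An $\alpha$-approximation outputs (with high probability) a safely connected subgraph with at most $\alpha$ times the optimal number of edges. $\tilde{O}$ hides polylogarithmic factors in $n$. *)

theory Defs
  imports
    "HOL-Probability.SPMF"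
    "HOL-Library.Landau_Symbols"
    "HOL-Library.Log_Nat"
begin

section \<open>Constrained connectivity\<close>

text \<open>Simple undirected graphs are given by a vertex set and a set of edges, each edge being a
  two-element set of vertices. A subgraph on all of the vertices is given by its edge set.\<close>

definition complete_edges :: "'v set \<Rightarrow> 'v set set" where
  "complete_edges V = {{u, v} |u v. u \<in> V \<and> v \<in> V \<and> u \<noteq> v}"

definition safe_sets :: "'v set \<Rightarrow> ('v \<Rightarrow> 'v \<Rightarrow> 'v set) \<Rightarrow> bool" where
  "safe_sets V S \<longleftrightarrow> (\<forall>u\<in>V. \<forall>v\<in>V. S u v \<subseteq> V \<and> u \<in> S u v \<and> v \<in> S u v)"

definition is_path :: "'v set set \<Rightarrow> 'v \<Rightarrow> 'v list \<Rightarrow> 'v \<Rightarrow> bool" where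
  "is_path F u p v \<longleftrightarrow> p \<noteq> [] \<and> hd p = u \<and> last p = v \<and> distinct p \<and>
     successively (\<lambda>x y. {x, y} \<in> F) p"

definition safely_connected :: "'v set \<Rightarrow> ('v \<Rightarrow> 'v \<Rightarrow> 'v set) \<Rightarrow> 'v set set \<Rightarrow> bool" where
  "safely_connected V S F \<longleftrightarrow> (\<forall>u\<in>V. \<forall>v\<in>V. \<exists>p. is_path F u p v \<and> set p \<subseteq> S u v)"

definition feasible :: "'v set \<Rightarrow> 'v set set \<Rightarrow> ('v \<Rightarrow> 'v \<Rightarrow> 'v set) \<Rightarrow> 'v set set \<Rightarrow> bool" where
  "feasible V E S F \<longleftrightarrow> F \<subseteq> E \<and> safely_connected V S F"

text \<open>Only meaningful if \<open>E\<close> is finite and a feasible subgraph exists; on a finite complete graph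
  this is always the case.\<close>

definition opt_sum :: "'v set \<Rightarrow> 'v set set \<Rightarrow> ('v \<Rightarrow> 'v \<Rightarrow> 'v set) \<Rightarrow> nat" where
  "opt_sum V E S = Min (card ` {F. feasible V E S F})"

definition approx_solution ::
  "real \<Rightarrow> 'v set \<Rightarrow> 'v set set \<Rightarrow> ('v \<Rightarrow> 'v \<Rightarrow> 'v set) \<Rightarrow> 'v set set \<Rightarrow> bool" where
  "approx_solution a V E S F \<longleftrightarrow> feasible V E S F \<and> real (card F) \<le> a * real (opt_sum V E S)"


section \<open>Randomized algorithms\<close>

text \<open>The model of computation is a random access machine with fair coin flips and logarithmic
  costs, programmed in a structured language. Its memory consists of natural-number variables and
  of unbounded arrays of natural numbers. A program mentions finitely many of these, so that
  interleaving them places everything in a single memory at the cost of a constant factor.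
  Every operation is charged for the bit lengths of its operands (and addresses); products and
  quotients are charged at the rate of the schoolbook methods. In particular, large numbers
  cannot be used to obtain cheap parallelism.\<close>

type_synonym vname = string

datatype aexp =
    Const nat
  | Var vname
  | Arr vname aexp
  | Plus aexp aexp
  | Minus aexp aexp
  | Times aexp aexp
  | Div aexp aexp

datatype bexp =
    Less aexp aexp
  | Neg bexp
  | Conj bexp bexp

datatype com =
    SKIP
  | Assign vname aexp
  | Store vname aexp aexp \<comment> \<open>array, index, new value\<close>
  | Flip vname
  | Seq com com
  | Cond bexp com com
  | While bexp com

record config =
  var :: "vname \<Rightarrow> nat"
  arr :: "vname \<Rightarrow> nat \<Rightarrow> nat"
  time :: nat

text \<open>Subtraction is truncated and division by zero yields zero, as in HOL.\<close>

primrec aval :: "aexp \<Rightarrow> config \<Rightarrow> nat" where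
  "aval (Const k) s = k"
| "aval (Var x) s = var s x"
| "aval (Arr a e) s = arr s a (aval e s)"
| "aval (Plus e f) s = aval e s + aval f s"
| "aval (Minus e f) s = aval e s - aval f s"
| "aval (Times e f) s = aval e s * aval f s"
| "aval (Div e f) s = aval e s div aval f s"

primrec bval :: "bexp \<Rightarrow> config \<Rightarrow> bool" where
  "bval (Less e f) s \<longleftrightarrow> aval e s < aval f s"
| "bval (Neg b) s \<longleftrightarrow> \<not> bval b s"
| "bval (Conj b c) s \<longleftrightarrow> bval b s \<and> bval c s"

text \<open>The successor makes the cost of every elementary operation positive, also on zeros.\<close>

definition bits :: "nat \<Rightarrow> nat" where
  "bits k = Suc (floorlog 2 k)"

primrec acost :: "aexp \<Rightarrow> config \<Rightarrow> nat" where
  "acost (Const k) s = bits k"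
| "acost (Var x) s = bits (var s x)"
| "acost (Arr a e) s = acost e s + bits (aval e s) + bits (arr s a (aval e s))"
| "acost (Plus e f) s = acost e s + acost f s + bits (aval e s) + bits (aval f s)"
| "acost (Minus e f) s = acost e s + acost f s + bits (aval e s) + bits (aval f s)"
| "acost (Times e f) s = acost e s + acost f s + bits (aval e s) * bits (aval f s)"
| "acost (Div e f) s = acost e s + acost f s + bits (aval e s) * bits (aval f s)"

primrec bcost :: "bexp \<Rightarrow> config \<Rightarrow> nat" where
  "bcost (Less e f) s = acost e s + acost f s + bits (aval e s) + bits (aval f s)"
| "bcost (Neg b) s = bcost b s + 1"
| "bcost (Conj b c) s = bcost b s + bcost c s + 1"

definition tick :: "nat \<Rightarrow> config \<Rightarrow> config" where
  "tick k s = s\<lparr>time := time s + k\<rparr>"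

definition set_var :: "vname \<Rightarrow> nat \<Rightarrow> config \<Rightarrow> config" where
  "set_var x k s = s\<lparr>var := (var s)(x := k)\<rparr>"

definition set_arr :: "vname \<Rightarrow> nat \<Rightarrow> nat \<Rightarrow> config \<Rightarrow> config" where
  "set_arr a i k s = s\<lparr>arr := (arr s)(a := (arr s a)(i := k))\<rparr>"

text \<open>A program denotes the subprobability distribution of its final configurations; the missing
  mass is the probability of divergence.\<close>

partial_function (spmf) run_while ::
  "bexp \<Rightarrow> (config \<Rightarrow> config spmf) \<Rightarrow> config \<Rightarrow> config spmf" where
  "run_while b body s =
     (if bval b s then bind_spmf (body (tick (bcost b s) s)) (run_while b body)
      else return_spmf (tick (bcost b s) s))"

primrec run :: "com \<Rightarrow> config \<Rightarrow> config spmf" where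
  "run SKIP s = return_spmf (tick 1 s)"
| "run (Assign x e) s = return_spmf (tick (acost e s + 1) (set_var x (aval e s) s))"
| "run (Store a e f) s =
     return_spmf (tick (acost e s + acost f s + 1) (set_arr a (aval e s) (aval f s) s))"
| "run (Flip x) s = map_spmf (\<lambda>b. tick 1 (set_var x (of_bool b) s)) coin_spmf"
| "run (Seq c d) s = bind_spmf (run c s) (run d)"
| "run (Cond b c d) s =
     (if bval b s then run c (tick (bcost b s) s) else run d (tick (bcost b s) s))"
| "run (While b c) s = run_while b (run c) s"

text \<open>Termination within the time bound holds for all outcomes of the coin flips.\<close>

definition runs_within :: "com \<Rightarrow> config \<Rightarrow> real \<Rightarrow> bool" where
  "runs_within c s t \<longleftrightarrow> lossless_spmf (run c s) \<and> (\<forall>s'\<in>set_spmf (run c s). real (time s') \<le> t)"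


section \<open>Algorithms for constrained connectivity on complete graphs\<close>

text \<open>The vertices of the complete graph are \<open>0, \<dots>, n - 1\<close>. Initially the variable \<open>n\<close> holds the number of
  vertices and cell \<open>(u * n + v) * n + w\<close> of array \<open>S\<close> tells whether \<open>w\<close> is in the safe set of \<open>(u, v)\<close>;
  everything else is zero. The final content of the array \<open>F\<close> is read as the upper triangle of an
  adjacency matrix.\<close>

definition input_config :: "nat \<Rightarrow> (nat \<Rightarrow> nat \<Rightarrow> nat set) \<Rightarrow> config" where
  "input_config n S =
     \<lparr>var = (\<lambda>_. 0)(''n'' := n),
      arr = (\<lambda>_ _. 0)(''S'' :=
        (\<lambda>i. of_bool (i < n ^ 3 \<and> i mod n \<in> S (i div n div n) (i div n mod n)))),
      time = 0\<rparr>"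

definition output_edges :: "nat \<Rightarrow> config \<Rightarrow> nat set set" where
  "output_edges n s = {{u, v} |u v. u < v \<and> v < n \<and> arr s ''F'' (u * n + v) \<noteq> 0}"

text \<open>\<open>soft_O g\<close> is \<open>O\<close> of \<open>g\<close> up to polylogarithmic factors.\<close>

definition soft_O :: "(nat \<Rightarrow> real) \<Rightarrow> (nat \<Rightarrow> real) set" where
  "soft_O g = {f. \<exists>k :: nat. f \<in> O(\<lambda>n. g n * ln (real n) ^ k)}"

end

theory Submission
  imports Defs "HOL-Real_Asymp.Real_Asymp"
begin

text \<open>The algorithm is deterministic. Let \<open>k\<close> be about \<open>n\<close> to the power \<open>1/3\<close>. If \<open>w\<close> is in the safe set of
  \<open>(u, v)\<close>, then the star centred at \<open>w\<close> connects \<open>u\<close> and \<open>v\<close> safely. A greedy hitting set for the safe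
  sets of size at least \<open>k\<close> consists of \<open>O((n / k) log n)\<close> centres, whose stars have
  \<open>O((n\<^sup>2 / k) log n)\<close> edges; this is compared with the bound \<open>OPT \<ge> n / 2\<close>. Then, whenever a pair is
  not yet safely connected, its safe set has fewer than \<open>k\<close> elements, and all edges within it are added.
  An optimal solution contains one of the edges that are new in this step, so that there are at most
  \<open>OPT\<close> such steps, each adding at most \<open>k\<^sup>2\<close> edges.\<close>

section \<open>Weakest preconditions with running time\<close>

text \<open>The exponent comes from balancing two ratios: measured against the optimum, the stars
  cost a factor of about \<open>(n / k) log n\<close> and the cliques a factor of
  \<open>k^2\<close>, and these agree up to the logarithm when \<open>k\<close> is the cube root of
  \<open>n\<close>. The greedy choice replaces a random sample of centres, which would hit all large
  safe sets only with high probability; so every run ends in a point distribution and succeeds with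
  probability 1. The obstacle is the machine: operations are charged by bit length, so a time bound
  needs bounds on all intermediate values. These never exceed \<open>2 * n^3\<close>; hence every
  elementary step has polylogarithmic cost, and it remains to count steps. To make this count a
  function of \<open>n\<close> and the program text alone, all loops run for a fixed number of
  rounds and idle when nothing is left to do. Reachability dominates: \<open>n^2\<close> pairs,
  \<open>n^2\<close> rounds for each, \<open>n^2\<close> potential links per round.\<close>

abbreviation mem :: "(vname \<Rightarrow> nat) \<Rightarrow> (vname \<Rightarrow> nat \<Rightarrow> nat) \<Rightarrow> config" where
  "mem v a \<equiv> \<lparr>var = v, arr = a, time = 0\<rparr>"

text \<open>Expressions cannot read the clock, so assertions may range over variables and arrays
  alone, with the clock fixed to 0 in \<open>mem\<close>.\<close>

lemma aval_mem: "aval e s = aval e (mem (var s) (arr s))"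
  by (induction e) auto

lemma bval_mem: "bval b s = bval b (mem (var s) (arr s))"
  by (induction b) (auto simp flip: aval_mem)

lemma acost_mem: "acost e s = acost e (mem (var s) (arr s))"
  by (induction e) (auto simp flip: aval_mem)

lemma bcost_mem: "bcost b s = bcost b (mem (var s) (arr s))"
  by (induction b) (auto simp flip: aval_mem acost_mem)

section \<open>Costs of expressions with bounded values\<close>

primrec abounded :: "nat \<Rightarrow> aexp \<Rightarrow> config \<Rightarrow> bool" where
  "abounded M (Const k) s \<longleftrightarrow> k \<le> M"
| "abounded M (Var x) s \<longleftrightarrow> var s x \<le> M"
| "abounded M (Arr a e) s \<longleftrightarrow> abounded M e s \<and> arr s a (aval e s) \<le> M"
| "abounded M (Plus e f) s \<longleftrightarrow> abounded M e s \<and> abounded M f s \<and> aval e s + aval f s \<le> M"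
| "abounded M (Minus e f) s \<longleftrightarrow> abounded M e s \<and> abounded M f s"
| "abounded M (Times e f) s \<longleftrightarrow> abounded M e s \<and> abounded M f s \<and> aval e s * aval f s \<le> M"
| "abounded M (Div e f) s \<longleftrightarrow> abounded M e s \<and> abounded M f s"

primrec bbounded :: "nat \<Rightarrow> bexp \<Rightarrow> config \<Rightarrow> bool" where
  "bbounded M (Less e f) s \<longleftrightarrow> abounded M e s \<and> abounded M f s"
| "bbounded M (Neg b) s \<longleftrightarrow> bbounded M b s"
| "bbounded M (Conj b c) s \<longleftrightarrow> bbounded M b s \<and> bbounded M c s"

text \<open>Each node weighs at least as many multiples of \<open>(bits M)^2\<close> as its own cost
  requires: the 2 pays for two bit lengths, or for one product of bit lengths.\<close>

primrec asize :: "aexp \<Rightarrow> nat" where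
  "asize (Const k) = 1"
| "asize (Var x) = 1"
| "asize (Arr a e) = asize e + 2"
| "asize (Plus e f) = asize e + asize f + 2"
| "asize (Minus e f) = asize e + asize f + 2"
| "asize (Times e f) = asize e + asize f + 2"
| "asize (Div e f) = asize e + asize f + 2"

primrec bsize :: "bexp \<Rightarrow> nat" where
  "bsize (Less e f) = asize e + asize f + 2"
| "bsize (Neg b) = bsize b + 1"
| "bsize (Conj b c) = bsize b + bsize c + 1"

lemma bits_pos: "bits k \<ge> 1"
  by (simp add: bits_def)

lemma bits_mono: "k \<le> M \<Longrightarrow> bits k \<le> bits M"
  by (simp add: bits_def floorlog_mono)

lemma bits_mult_le_square: "\<lbrakk>k \<le> M; l \<le> M\<rbrakk> \<Longrightarrow> bits k * bits l \<le> (bits M)\<^sup>2"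
  by (simp add: bits_mono mult_le_mono power2_eq_square)

lemma bits_le_square:
  assumes "k \<le> M"
  shows "bits k \<le> (bits M)\<^sup>2"
proof -
  have "bits k * 1 \<le> bits k * bits M"
    using bits_pos by (intro mult_le_mono2)
  from le_trans[OF this bits_mult_le_square[OF assms order.refl]] show ?thesis
    by (simp only: mult_1_right)
qed

text \<open>Truncated subtraction and division never exceed their first operand, which is why
  \<open>abounded\<close> puts no condition on their results.\<close>

lemma aval_le: "abounded M e s \<Longrightarrow> aval e s \<le> M"
  by (induction e) (auto intro: le_trans[OF diff_le_self] le_trans[OF div_le_dividend])

lemma acost_le: "abounded M e s \<Longrightarrow> acost e s \<le> asize e * (bits M)\<^sup>2"
proof (induction e)
  case (Arr a e)
  then show ?case
    using bits_le_square[of "aval e s" M] bits_le_square[of "arr s a (aval e s)" M] aval_le[of M e s]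
    by (simp add: distrib_right)
next
  case (Plus e f)
  then show ?case
    using bits_le_square[of "aval e s" M] bits_le_square[of "aval f s" M]
      aval_le[of M e s] aval_le[of M f s]
    by (simp add: distrib_right)
next
  case (Minus e f)
  then show ?case
    using bits_le_square[of "aval e s" M] bits_le_square[of "aval f s" M]
      aval_le[of M e s] aval_le[of M f s]
    by (simp add: distrib_right)
next
  case (Times e f)
  then show ?case
    using bits_mult_le_square[of "aval e s" M "aval f s"] aval_le[of M e s] aval_le[of M f s]
    by (simp add: distrib_right)
next
  case (Div e f)
  then show ?case
    using bits_mult_le_square[of "aval e s" M "aval f s"] aval_le[of M e s] aval_le[of M f s]
    by (simp add: distrib_right)
qed (auto intro: bits_le_square)

lemma bcost_le: "bbounded M b s \<Longrightarrow> bcost b s \<le> bsize b * (bits M)\<^sup>2"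
proof (induction b)
  case (Less e f)
  then show ?case
    using bits_le_square[of "aval e s" M] bits_le_square[of "aval f s" M]
      aval_le[of M e s] aval_le[of M f s] acost_le[of M e s] acost_le[of M f s]
    by (simp add: distrib_right)
next
  case (Neg b)
  then show ?case
    using one_le_power[OF bits_pos[of M], of 2] by simp
next
  case (Conj b c)
  then show ?case
    using one_le_power[OF bits_pos[of M], of 2] by (simp add: distrib_right)
qed

text \<open>The largest numbers are the indices \<open>p * n + w\<close> into \<open>S\<close> with
  \<open>p < n * n\<close> and \<open>w \<le> n\<close>, where each summand is at most
  \<open>n^3\<close>; the cube tested for the threshold is at most \<open>n^3\<close> as
  well.\<close>

definition value_bound :: "nat \<Rightarrow> nat" where
  "value_bound n = 2 * n ^ 3"

text \<open>No elementary command of the program contains expressions of total size 100 or more.\<close>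

definition step_cost :: "nat \<Rightarrow> nat" where
  "step_cost n = 100 * (bits (value_bound n))\<^sup>2"

text \<open>All loops of the program run up to one of the variables \<open>n\<close> and \<open>m\<close>, the latter holding
  \<open>n * n\<close>.\<close>

definition iterations :: "nat \<Rightarrow> bexp \<Rightarrow> nat" where
  "iterations n b = (case b of Less e f \<Rightarrow> if f = Var ''m'' then n * n else n | _ \<Rightarrow> 0)"

text \<open>Read off the program text and \<open>n\<close> alone: a conditional is charged for both
  branches, and the leading 1 of a loop is the final, failing test of its guard.\<close>

primrec steps :: "nat \<Rightarrow> com \<Rightarrow> nat" where
  "steps n SKIP = 1"
| "steps n (Assign x e) = 1"
| "steps n (Store a e f) = 1"
| "steps n (Flip x) = 1"
| "steps n (Seq c d) = steps n c + steps n d"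
| "steps n (Cond b c d) = 1 + steps n c + steps n d"
| "steps n (While b c) = 1 + iterations n b * (1 + steps n c)"

text \<open>Demanding a point distribution puts termination, determinism and the time bound into a
  single predicate. The starting clock is arbitrary, so that the bounds of consecutive commands add
  up.\<close>

definition wp ::
  "nat \<Rightarrow> com \<Rightarrow> ((vname \<Rightarrow> nat) \<Rightarrow> (vname \<Rightarrow> nat \<Rightarrow> nat) \<Rightarrow> bool) \<Rightarrow>
    (vname \<Rightarrow> nat) \<Rightarrow> (vname \<Rightarrow> nat \<Rightarrow> nat) \<Rightarrow> bool" where
  "wp n c Q v a \<longleftrightarrow> (\<forall>s. var s = v \<longrightarrow> arr s = a \<longrightarrow>
     (\<exists>s'. run c s = return_spmf s' \<and> Q (var s') (arr s') \<and>
        time s' \<le> time s + steps n c * step_cost n))"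

section \<open>Proof rules for commands\<close>

lemma wp_mono: "wp n c Q v a \<Longrightarrow> (\<And>v a. Q v a \<Longrightarrow> R v a) \<Longrightarrow> wp n c R v a"
  unfolding wp_def by blast

text \<open>The \<open>+ 1\<close> is the unit that assignments charge on top of their expressions;
  it fits because a squared bit length is at least 1 and \<open>l\<close> is strictly below
  100.\<close>

lemma step_cost_ge:
  assumes "k \<le> l * (bits (value_bound n))\<^sup>2" "l < 100"
  shows "k + 1 \<le> step_cost n"
proof -
  have "k + 1 \<le> (l + 1) * (bits (value_bound n))\<^sup>2"
    using assms(1) one_le_power[OF bits_pos[of "value_bound n"], of 2] by simp
  also have "\<dots> \<le> step_cost n"
    unfolding step_cost_def using assms(2) by (intro mult_le_mono1) simp
  finally show ?thesis .
qed

lemma wp_SKIP: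
  assumes "Q v a"
  shows "wp n SKIP Q v a"
  unfolding wp_def
  using assms step_cost_ge[of 0 0 n] by (auto simp: tick_def)

lemma wp_Assign:
  assumes "abounded (value_bound n) e (mem v a)" "asize e < 100" "Q (v(x := aval e (mem v a))) a"
  shows "wp n (Assign x e) Q v a"
  unfolding wp_def
proof (intro allI impI)
  fix s :: config assume s: "var s = v" "arr s = a"
  have "acost e s + 1 \<le> step_cost n"
    using step_cost_ge[OF acost_le[OF assms(1)] assms(2)] acost_mem[of e s] s by simp
  then show "\<exists>s'. run (Assign x e) s = return_spmf s' \<and> Q (var s') (arr s') \<and>
      time s' \<le> time s + steps n (Assign x e) * step_cost n"
    using assms(3) s aval_mem[of e s] by (auto simp: tick_def set_var_def)
qed

lemma wp_Store:
  assumes "abounded (value_bound n) e (mem v a)" "abounded (value_bound n) f (mem v a)"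
    "asize e + asize f < 100"
    "Q v (a(A := (a A)(aval e (mem v a) := aval f (mem v a))))"
  shows "wp n (Store A e f) Q v a"
  unfolding wp_def
proof (intro allI impI)
  fix s :: config assume s: "var s = v" "arr s = a"
  have "acost e (mem v a) + acost f (mem v a) \<le> (asize e + asize f) * (bits (value_bound n))\<^sup>2"
    using acost_le[OF assms(1)] acost_le[OF assms(2)] by (simp add: distrib_right)
  then have "acost e s + acost f s + 1 \<le> step_cost n"
    using step_cost_ge[OF _ assms(3)] acost_mem[of e s] acost_mem[of f s] s by simp
  then show "\<exists>s'. run (Store A e f) s = return_spmf s' \<and> Q (var s') (arr s') \<and>
      time s' \<le> time s + steps n (Store A e f) * step_cost n"
    using assms(4) s aval_mem[of e s] aval_mem[of f s] by (auto simp: tick_def set_arr_def)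
qed

lemma wp_Seq:
  assumes "wp n c (wp n d Q) v a"
  shows "wp n (Seq c d) Q v a"
  unfolding wp_def
proof (intro allI impI)
  fix s :: config assume s: "var s = v" "arr s = a"
  then obtain s' where s': "run c s = return_spmf s'" "wp n d Q (var s') (arr s')"
    "time s' \<le> time s + steps n c * step_cost n"
    using assms unfolding wp_def by blast
  then obtain s'' where s'': "run d s' = return_spmf s''" "Q (var s'') (arr s'')"
    "time s'' \<le> time s' + steps n d * step_cost n"
    unfolding wp_def by blast
  show "\<exists>s'. run (Seq c d) s = return_spmf s' \<and> Q (var s') (arr s') \<and>
      time s' \<le> time s + steps n (Seq c d) * step_cost n"
    using s' s'' by (intro exI[of _ s'']) (simp add: distrib_right)
qed

lemma bcost_step:
  assumes "bbounded (value_bound n) b (mem (var s) (arr s))" "bsize b < 100"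
  shows "bcost b s \<le> step_cost n"
  using step_cost_ge[OF bcost_le[OF assms(1)] assms(2)] bcost_mem[of b s] by simp

lemma wp_Cond:
  assumes "bbounded (value_bound n) b (mem v a)" "bsize b < 100"
    and "bval b (mem v a) \<Longrightarrow> wp n c Q v a"
    and "\<not> bval b (mem v a) \<Longrightarrow> wp n d Q v a"
  shows "wp n (Cond b c d) Q v a"
  unfolding wp_def
proof (intro allI impI)
  fix s :: config assume s: "var s = v" "arr s = a"
  define s0 where "s0 = tick (bcost b s) s"
  have s0: "var s0 = v" "arr s0 = a" "time s0 \<le> time s + step_cost n"
    using s bcost_step[of n b s] assms(1,2) by (auto simp: s0_def tick_def)
  define e where "e = (if bval b s then c else d)"
  have "wp n e Q v a"
    using assms(3,4) s bval_mem[of b s] by (auto simp: e_def)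
  then obtain s' where s': "run e s0 = return_spmf s'" "Q (var s') (arr s')"
    "time s' \<le> time s0 + steps n e * step_cost n"
    using s0 unfolding wp_def by blast
  have "run (Cond b c d) s = return_spmf s'"
    using s'(1) by (simp add: e_def s0_def split: if_splits)
  moreover have "time s' \<le> time s + (1 + steps n e) * step_cost n"
    using s'(3) s0(3) by simp
  moreover have "(1 + steps n e) * step_cost n \<le> steps n (Cond b c d) * step_cost n"
    by (intro mult_le_mono1) (simp add: e_def)
  ultimately show "\<exists>s'. run (Cond b c d) s = return_spmf s' \<and> Q (var s') (arr s') \<and>
      time s' \<le> time s + steps n (Cond b c d) * step_cost n"
    using s'(2) by (meson le_trans nat_add_left_cancel_le)
qed

text \<open>\<open>I\<close> is invariant and variant in one: \<open>j\<close> is the exact number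
  of iterations to come, as the guard holds iff \<open>j > 0\<close>. Starting at
  \<open>iterations n g\<close> ties it to the syntactic count.\<close>

lemma wp_While:
  assumes "bsize g < 100"
    and init: "I (iterations n g) v a"
    and bounded: "\<And>j v a. I j v a \<Longrightarrow> bbounded (value_bound n) g (mem v a)"
    and continue: "\<And>j v a. I j v a \<Longrightarrow> bval g (mem v a) \<longleftrightarrow> j > 0"
    and body: "\<And>j v a. I (Suc j) v a \<Longrightarrow> wp n c (I j) v a"
    and final: "\<And>v a. I 0 v a \<Longrightarrow> Q v a"
  shows "wp n (While g c) Q v a"
proof -
  have "\<exists>s'. run (While g c) s = return_spmf s' \<and> Q (var s') (arr s') \<and>
      time s' \<le> time s + (1 + j * (1 + steps n c)) * step_cost n"
    if "I j (var s) (arr s)" for j s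
    using that
  proof (induction j arbitrary: s)
    case 0
    have "run (While g c) s = return_spmf (tick (bcost g s) s)"
      using continue[OF 0] bval_mem[of g s] by (simp add: run_while.simps)
    then show ?case
      using final[OF 0] bcost_step[OF bounded[OF 0] assms(1)]
      by (intro exI[of _ "tick (bcost g s) s"]) (simp add: tick_def)
  next
    case (Suc j)
    define s0 where "s0 = tick (bcost g s) s"
    have s0: "var s0 = var s" "arr s0 = arr s" "time s0 \<le> time s + step_cost n"
      using bcost_step[OF bounded[OF Suc.prems] assms(1)] by (auto simp: s0_def tick_def)
    obtain s1 where s1: "run c s0 = return_spmf s1" "I j (var s1) (arr s1)"
      "time s1 \<le> time s0 + steps n c * step_cost n"
      using body[OF Suc.prems] s0 unfolding wp_def by blast
    obtain s' where s': "run (While g c) s1 = return_spmf s'" "Q (var s') (arr s')"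
      "time s' \<le> time s1 + (1 + j * (1 + steps n c)) * step_cost n"
      using Suc.IH[OF s1(2)] by blast
    have "run (While g c) s = run (While g c) s1"
      using continue[OF Suc.prems] bval_mem[of g s] s1(1)
      by (subst run.simps, subst run_while.simps) (simp add: s0_def)
    moreover have "time s' \<le> time s + (1 + Suc j * (1 + steps n c)) * step_cost n"
      using s'(3) s1(3) s0(3) by (simp add: algebra_simps)
    ultimately show ?case
      using s' by auto
  qed
  then show ?thesis
    unfolding wp_def using init by (auto simp del: run.simps)
qed

section \<open>Counted loops\<close>

definition For :: "vname \<Rightarrow> vname \<Rightarrow> com \<Rightarrow> com" where
  "For x b c = Seq (Assign x (Const 0))
     (While (Less (Var x) (Var b)) (Seq c (Assign x (Plus (Var x) (Const 1)))))"

lemma value_boundI: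
  assumes "k \<le> n ^ 3"
  shows "k \<le> value_bound n"
  using assms by (simp add: value_bound_def)

text \<open>The index of \<open>I\<close> is the number of completed rounds. The increment of
  \<open>x\<close> belongs to the rule, so the body has to preserve \<open>x = i\<close> and to
  establish \<open>I (Suc i)\<close> for the store after the increment; \<open>bound\<close> keeps
  the limit from changing.\<close>

lemma wp_For:
  assumes n: "n \<ge> 1"
    and N: "N = (if b = ''m'' then n * n else n)"
    and x: "x \<noteq> b"
    and init: "I 0 (v(x := 0)) a"
    and bound: "\<And>i v a. I i v a \<Longrightarrow> v b = N"
    and body: "\<And>i v a. i < N \<Longrightarrow> v x = i \<Longrightarrow> I i v a \<Longrightarrow>
      wp n c (\<lambda>v a. v x = i \<and> I (Suc i) (v(x := Suc i)) a) v a"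
    and final: "\<And>v a. v x = N \<Longrightarrow> I N v a \<Longrightarrow> Q v a"
  shows "wp n (For x b c) Q v a"
proof -
  have "n \<le> n ^ 3" "n * n \<le> n ^ 3"
    using n by (simp_all add: power3_eq_cube)
  then have N3: "N \<le> value_bound n"
    using N by (auto intro: value_boundI)
  have pos: "1 \<le> value_bound n"
    using n by (intro value_boundI) (simp add: one_le_power del: One_nat_def)
  \<comment> \<open>The while rule counts the rounds that remain, hence the reflection
    \<open>N - j\<close>.\<close>
  let ?I = "\<lambda>j v a. j \<le> N \<and> v x = N - j \<and> I (N - j) v a"
  have iterations: "iterations n (Less (Var x) (Var b)) = N"
    by (simp add: iterations_def N)
  show ?thesis
    unfolding For_def
  proof (rule wp_Seq, rule wp_Assign)
    show "wp n (While (Less (Var x) (Var b)) (Seq c (Assign x (Plus (Var x) (Const 1))))) Q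
        (v(x := aval (Const 0) (mem v a))) a"
    proof (rule wp_While[where I = ?I])
      fix j v a assume I: "?I (Suc j) v a"
      show "wp n (Seq c (Assign x (Plus (Var x) (Const 1)))) (?I j) v a"
      proof (rule wp_Seq, rule wp_mono[OF body[of "N - Suc j"]])
        fix v' a' assume v': "v' x = N - Suc j \<and> I (Suc (N - Suc j)) (v'(x := Suc (N - Suc j))) a'"
        have "Suc (N - Suc j) = N - j"
          using conjunct1[OF I] by arith
        then show "wp n (Assign x (Plus (Var x) (Const 1))) (?I j) v' a'"
          using v' I N3 pos by (intro wp_Assign) auto
      qed (use I in auto)
    next
      fix v a assume "?I 0 v a"
      then show "Q v a"
        using final by simp
    qed (use init N3 iterations in \<open>auto dest: bound\<close>)
  qed auto
qed

definition Count :: "vname \<Rightarrow> vname \<Rightarrow> bexp \<Rightarrow> com" where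
  "Count x b g = Seq (Assign ''c'' (Const 0))
     (For x b (Cond g (Assign ''c'' (Plus (Var ''c'') (Const 1))) SKIP))"

definition Mark :: "vname \<Rightarrow> vname \<Rightarrow> bexp \<Rightarrow> vname \<Rightarrow> nat \<Rightarrow> com" where
  "Mark x b g A k = For x b (Cond g (Store A (Var x) (Const k)) SKIP)"

lemma card_less_Suc:
  "card {i. i < Suc k \<and> P i} = card {i. i < k \<and> P i} + of_bool (P k)"
proof -
  have "{i. i < Suc k \<and> P i} = {i. i < k \<and> P i} \<union> (if P k then {k} else {})"
    by (auto simp: less_Suc_eq)
  then show ?thesis
    by simp
qed

lemma card_less_le: "card {i. i < k \<and> P i} \<le> (k :: nat)"
  using card_mono[of "{..<k}" "{i. i < k \<and> P i}"] by auto

lemma value_bound_simps: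
  assumes "n \<ge> 1"
  shows "Suc 0 \<le> value_bound n" "n \<le> value_bound n" "n * n \<le> value_bound n"
proof -
  have "n \<le> n ^ 3" "n * n \<le> n ^ 3" "1 \<le> n ^ 3"
    using assms by (simp_all add: power3_eq_cube)
  then show "Suc 0 \<le> value_bound n" "n \<le> value_bound n" "n * n \<le> value_bound n"
    by (auto intro: value_boundI)
qed

text \<open>After \<open>i\<close> tests the counter is the size of a subset of \<open>i\<close>
  indices. The alternative \<open>c > i\<close> in \<open>g\<close> therefore confines the
  boundedness of the guard to counters that can occur.\<close>

lemma wp_Count:
  assumes n: "n \<ge> 1"
    and N: "N = (if b = ''m'' then n * n else n)"
    and x: "x \<noteq> b" "x \<noteq> ''c''" "b \<noteq> ''c''"
    and vb: "v b = N"
    and size: "bsize g < 100"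
    and g: "\<And>i c. i < N \<Longrightarrow> bbounded (value_bound n) g (mem (v(''c'' := c, x := i)) a) \<or> c > i"
    and P: "\<And>i c. i < N \<Longrightarrow> bval g (mem (v(''c'' := c, x := i)) a) \<longleftrightarrow> P i"
    and Q: "Q (v(''c'' := card {i. i < N \<and> P i}, x := N)) a"
  shows "wp n (Count x b g) Q v a"
proof -
  have N': "N \<le> value_bound n"
    using value_bound_simps[OF n] N by auto
  let ?I = "\<lambda>i v' a'. v' = v(''c'' := card {j. j < i \<and> P j}, x := v' x) \<and> a' = a"
  show ?thesis
    unfolding Count_def
  proof (intro wp_Seq wp_Assign wp_For[OF n N x(1), where I = ?I])
    fix i v' a' assume i: "i < N" "v' x = i" "?I i v' a'"
    have c: "card {j. j < i \<and> P j} \<le> i"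
      by (rule card_less_le)
    have v': "v' = v(''c'' := card {j. j < i \<and> P j}, x := i)" "a' = a"
      using i by simp_all
    show "wp n (Cond g (Assign ''c'' (Plus (Var ''c'') (Const 1))) SKIP)
        (\<lambda>v a. v x = i \<and> ?I (Suc i) (v(x := Suc i)) a) v' a'"
      unfolding v'
    proof (rule wp_Cond)
      show "bbounded (value_bound n) g (mem (v(''c'' := card {j. j < i \<and> P j}, x := i)) a)"
        using g[OF i(1)] c not_less by blast
    next
      assume "bval g (mem (v(''c'' := card {j. j < i \<and> P j}, x := i)) a)"
      then have "P i"
        using P[OF i(1)] by simp
      then show "wp n (Assign ''c'' (Plus (Var ''c'') (Const 1)))
        (\<lambda>v' a'. v' x = i \<and> ?I (Suc i) (v'(x := Suc i)) a') (v(''c'' := card {j. j < i \<and> P j}, x := i)) a"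
        using c i N' x value_bound_simps[OF n]
        by (intro wp_Assign) (auto simp: card_less_Suc fun_eq_iff)
    next
      assume "\<not> bval g (mem (v(''c'' := card {j. j < i \<and> P j}, x := i)) a)"
      then have "\<not> P i"
        using P[OF i(1)] by simp
      then show "wp n SKIP
        (\<lambda>v' a'. v' x = i \<and> ?I (Suc i) (v'(x := Suc i)) a') (v(''c'' := card {j. j < i \<and> P j}, x := i)) a"
        using x by (intro wp_SKIP) (auto simp: card_less_Suc fun_eq_iff)
    qed (use size in auto)
  next
    fix i v' a' assume "?I i v' a'"
    then show "v' b = N"
      using vb x by (metis fun_upd_other)
  next
    fix v' a' assume "v' x = N" "?I N v' a'"
    then show "Q v' a'"
      using Q by metis
  qed (use x in auto)
qed

text \<open>The guard must have the same truth value for every content \<open>f\<close> of the array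
  being written. Earlier stores then cannot influence later tests, and the loop amounts to one
  simultaneous update.\<close>

lemma wp_Mark:
  assumes n: "n \<ge> 1"
    and N: "N = (if b = ''m'' then n * n else n)"
    and x: "x \<noteq> b"
    and vb: "v b = N"
    and size: "bsize g < 99"
    and k: "k \<le> 1"
    and g: "\<And>i f. i < N \<Longrightarrow> (\<And>j. f j \<le> 1) \<Longrightarrow>
      bbounded (value_bound n) g (mem (v(x := i)) (a(A := f)))"
    and P: "\<And>i f. i < N \<Longrightarrow> bval g (mem (v(x := i)) (a(A := f))) \<longleftrightarrow> P i"
    and A: "\<And>i. a A i \<le> 1"
    and Q: "Q (v(x := N)) (a(A := (\<lambda>i. if i < N \<and> P i then k else a A i)))"
  shows "wp n (Mark x b g A k) Q v a"
proof -
  have N': "N \<le> value_bound n"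
    using value_bound_simps[OF n] N by auto
  have k': "k \<le> value_bound n"
    using value_bound_simps[OF n] k by simp
  let ?f = "\<lambda>i j. if j < i \<and> P j then k else a A j"
  let ?I = "\<lambda>i v' a'. v' = v(x := v' x) \<and> a' = a(A := ?f i)"
  show ?thesis
    unfolding Mark_def
  proof (intro wp_For[OF n N x, where I = ?I])
    fix i v' a' assume i: "i < N" "v' x = i" "?I i v' a'"
    have v': "v' = v(x := i)" "a' = a(A := ?f i)"
      using i by simp_all
    have f: "?f i j \<le> 1" for j
      using A k by simp
    show "wp n (Cond g (Store A (Var x) (Const k)) SKIP)
        (\<lambda>v a. v x = i \<and> ?I (Suc i) (v(x := Suc i)) a) v' a'"
      unfolding v'
    proof (rule wp_Cond)
      show "bbounded (value_bound n) g (mem (v(x := i)) (a(A := ?f i)))"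
        by (rule g[OF i(1) f])
    next
      assume "bval g (mem (v(x := i)) (a(A := ?f i)))"
      then have "P i"
        using P[OF i(1)] by simp
      then have "(?f i)(i := k) = ?f (Suc i)"
        by (auto simp: fun_eq_iff less_Suc_eq)
      then show "wp n (Store A (Var x) (Const k))
        (\<lambda>v' a'. v' x = i \<and> ?I (Suc i) (v'(x := Suc i)) a') (v(x := i)) (a(A := ?f i))"
        using i N' k' by (intro wp_Store) auto
    next
      assume "\<not> bval g (mem (v(x := i)) (a(A := ?f i)))"
      then have "\<not> P i"
        using P[OF i(1)] by simp
      then have "?f i = ?f (Suc i)"
        by (auto simp: fun_eq_iff less_Suc_eq)
      then show "wp n SKIP
        (\<lambda>v' a'. v' x = i \<and> ?I (Suc i) (v'(x := Suc i)) a') (v(x := i)) (a(A := ?f i))"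
        by (intro wp_SKIP) (auto simp: fun_eq_iff)
    qed (use size in auto)
  next
    fix i v' a' assume "?I i v' a'"
    then show "v' b = N"
      using vb x by (metis fun_upd_other)
  next
    fix v' a' assume "v' x = N" "?I N v' a'"
    then show "Q v' a'"
      using Q by metis
  qed auto
qed

section \<open>Graphs and approximation bounds\<close>

text \<open>A directed relation makes reachability a reflexive transitive closure. Orientation and
  loops disappear only in \<open>undirected\<close>; symmetry is carried along as an
  invariant.\<close>

definition links :: "nat \<Rightarrow> (nat \<Rightarrow> nat) \<Rightarrow> (nat \<times> nat) set" where
  "links n f = {(x, y). x < n \<and> y < n \<and> 0 < f (x * n + y)}"

definition undirected :: "('a \<times> 'a) set \<Rightarrow> 'a set set" where
  "undirected G = {{x, y} |x y. (x, y) \<in> G \<and> x \<noteq> y}"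

definition star :: "nat \<Rightarrow> nat \<Rightarrow> (nat \<times> nat) set" where
  "star n z = {(x, y). x < n \<and> y < n \<and> (x = z \<or> y = z)}"

lemma finite_links [simp]: "finite (links n f)"
  by (rule finite_subset[of _ "{..<n} \<times> {..<n}"]) (auto simp: links_def)

lemma undirected_Un: "undirected (G \<union> H) = undirected G \<union> undirected H"
  by (auto simp: undirected_def)

lemma undirected_subset_image: "undirected G \<subseteq> (\<lambda>(x, y). {x, y}) ` G"
  by (auto simp: undirected_def)

lemma finite_undirected: "finite G \<Longrightarrow> finite (undirected G)"
  using finite_subset[OF undirected_subset_image] by blast

lemma card_undirected_le: "finite G \<Longrightarrow> card (undirected G) \<le> card G"
  using card_mono[OF _ undirected_subset_image[of G]] card_image_le[of G]
  by (meson finite_imageI le_trans)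

lemma card_undirected_star: "card (undirected (star n z)) \<le> n"
proof -
  have "undirected (star n z) \<subseteq> (\<lambda>x. {z, x}) ` {..<n}"
    by (auto simp: undirected_def star_def insert_commute)
  then have "card (undirected (star n z)) \<le> card ((\<lambda>x. {z, x}) ` {..<n})"
    by (intro card_mono) auto
  also have "\<dots> \<le> n"
    using card_image_le[of "{..<n}" "\<lambda>x. {z, x}"] by simp
  finally show ?thesis .
qed

lemma sym_star: "sym (star n z)"
  by (auto simp: sym_def star_def)

text \<open>The path is built from its end; when the new first vertex already lies on it, the detour
  is cut off, because \<open>is_path\<close> demands distinct vertices. \<open>v \<in> A\<close>
  serves the empty walk.\<close>

lemma rtrancl_imp_is_path:
  assumes "(u, v) \<in> (G \<inter> A \<times> A)\<^sup>*" and v: "v \<in> A"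
  shows "\<exists>p. is_path (undirected G) u p v \<and> set p \<subseteq> A"
  using assms(1)
proof (induction rule: converse_rtrancl_induct)
  case base
  then show ?case
    using v by (intro exI[of _ "[v]"]) (simp add: is_path_def)
next
  case (step u w)
  then obtain p where p: "is_path (undirected G) w p v" "set p \<subseteq> A"
    by blast
  show ?case
  proof (cases "u \<in> set p")
    case True
    \<comment> \<open>The suffix starting at \<open>u\<close> is again a simple path inside
      \<open>A\<close>.\<close>
    then obtain xs ys where "p = xs @ u # ys"
      by (meson split_list)
    then show ?thesis
      using p by (intro exI[of _ "u # ys"]) (auto simp: is_path_def successively_append_iff)
  next
    case False
    have "u \<noteq> w"
      using False p(1) by (auto simp: is_path_def)
    then have "{u, w} \<in> undirected G"
      using step.hyps(1) by (auto simp: undirected_def)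
    then show ?thesis
      using p False step.hyps(1)
      by (intro exI[of _ "u # p"]) (auto simp: is_path_def successively_Cons)
  qed
qed

lemma successively_imp_rtrancl:
  "\<lbrakk>successively (\<lambda>x y. (x, y) \<in> D) p; p \<noteq> []\<rbrakk> \<Longrightarrow> (hd p, last p) \<in> D\<^sup>*"
proof (induction p)
  case (Cons x p)
  then show ?case
    by (cases "p = []") (auto simp: successively_Cons intro: converse_rtrancl_into_rtrancl)
qed simp

text \<open>Otherwise all links of the path would lie in \<open>G\<close> and within
  \<open>A\<close>, and the path would witness the excluded reachability. This is the source of the
  new edges charged against a feasible subgraph.\<close>

lemma is_path_leaves:
  assumes "is_path F u p v" "set p \<subseteq> A" "(u, v) \<notin> (G \<inter> A \<times> A)\<^sup>*"
  obtains (leaves) x y where "{x, y} \<in> F" "x \<in> A" "y \<in> A" "(x, y) \<notin> G"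
proof (rule ccontr)
  assume neg: "\<not> thesis"
  have *: "(x, y) \<in> G" if "{x, y} \<in> F" "x \<in> A" "y \<in> A" for x y
    using leaves[OF that] neg by blast
  have "successively (\<lambda>x y. (x, y) \<in> G \<inter> A \<times> A) p"
    using assms(1) unfolding is_path_def
    by (auto intro!: successively_mono[of "\<lambda>x y. {x, y} \<in> F" p] * subsetD[OF assms(2)])
  then show False
    using successively_imp_rtrancl assms unfolding is_path_def by blast
qed

text \<open>With at least two vertices, each one must be joined to another and so lies on an edge,
  while an edge covers at most two vertices. This is the lower bound that pays for the
  stars.\<close>

lemma card_vertices_le:
  assumes "feasible {..<n} (complete_edges {..<n}) S F" "n \<ge> 2"
  shows "n \<le> 2 * card F"
proof -
  have F: "F \<subseteq> (\<lambda>(x, y). {x, y}) ` ({..<n} \<times> {..<n})"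
    using assms(1) by (auto simp: feasible_def complete_edges_def)
  then have fin: "finite F"
    by (rule finite_subset) auto
  have "{..<n} \<subseteq> \<Union>F"
  proof
    fix u assume u: "u \<in> {..<n}"
    define v where "v = (if u = 0 then 1 else 0 :: nat)"
    have v: "v \<in> {..<n}" "v \<noteq> u"
      using assms(2) by (auto simp: v_def)
    obtain p where p: "is_path F u p v"
      using assms(1) u v(1) unfolding feasible_def safely_connected_def by blast
    then obtain q where q: "p = u # q" "q \<noteq> []"
      using v(2) that unfolding is_path_def by (cases p; cases "tl p") auto
    then have "{u, hd q} \<in> F"
      using p by (auto simp: is_path_def successively_Cons)
    then show "u \<in> \<Union>F"
      by blast
  qed
  moreover have "finite (\<Union>F)"
    using fin F by (intro finite_Union) auto
  ultimately have "n \<le> card (\<Union>F)"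
    using card_mono[of "\<Union>F" "{..<n}"] by simp
  also have "\<dots> \<le> sum card F"
    by (rule card_Union_le_sum_card)
  also have "\<dots> \<le> (\<Sum>e\<in>F. 2)"
  proof (rule sum_mono)
    fix e assume "e \<in> F"
    then obtain x y where "e = {x, y}"
      using F by auto
    then show "card e \<le> 2"
      by (simp add: card_insert_if)
  qed
  finally show ?thesis
    by simp
qed

lemma opt_sum_attained:
  assumes "finite E" "feasible V E S F"
  obtains F' where "feasible V E S F'" "card F' = opt_sum V E S"
proof -
  have "{F. feasible V E S F} \<subseteq> Pow E"
    by (auto simp: feasible_def)
  then have "finite {F. feasible V E S F}"
    using assms(1) by (simp add: finite_subset)
  then have "opt_sum V E S \<in> card ` {F. feasible V E S F}"
    unfolding opt_sum_def using assms(2) by (intro Min_in) auto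
  then show ?thesis
    using that by auto
qed

text \<open>Double counting of the incidences \<open>w \<in> A p\<close>: summed over
  \<open>p\<close> there are at least \<open>k * card U\<close>, summed over \<open>w\<close> at
  most \<open>n * b\<close>. With \<open>b\<close> the maximal frequency, the greedy choice thus
  covers at least a \<open>k / n\<close> fraction of \<open>U\<close>.\<close>

lemma exists_frequent_element:
  fixes A :: "'b \<Rightarrow> nat set"
  assumes "finite U" "\<And>p. p \<in> U \<Longrightarrow> A p \<subseteq> {..<n} \<and> k \<le> card (A p)"
    and "\<And>w. w < n \<Longrightarrow> card {p \<in> U. w \<in> A p} \<le> b"
  shows "k * card U \<le> n * b"
proof -
  have "k * card U \<le> (\<Sum>p\<in>U. card (A p))"
    using sum_mono[of U "\<lambda>_. k" "\<lambda>p. card (A p)"] assms(2) by (simp add: mult.commute)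
  also have "\<dots> = (\<Sum>p\<in>U. \<Sum>w<n. of_bool (w \<in> A p))"
  proof (rule sum.cong)
    fix p assume "p \<in> U"
    then have "A p = {w \<in> {..<n}. w \<in> A p}"
      using assms(2) by blast
    then show "card (A p) = (\<Sum>w<n. of_bool (w \<in> A p))"
      by (simp add: of_bool_def sum.If_cases Int_def)
  qed simp
  also have "\<dots> = (\<Sum>w<n. \<Sum>p\<in>U. of_bool (w \<in> A p))"
    by (rule sum.swap)
  also have "\<dots> = (\<Sum>w<n. card {p \<in> U. w \<in> A p})"
    using assms(1) by (simp add: of_bool_def sum.If_cases Int_def)
  also have "\<dots> \<le> n * b"
    using sum_mono[of "{..<n}" "\<lambda>w. card {p \<in> U. w \<in> A p}" "\<lambda>_. b"] assms(3) by simp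
  finally show ?thesis .
qed

text \<open>From \<open>1 - x \<le> exp (- x)\<close> the hypothesis yields
  \<open>(j - 1) * (k / n) \<le> 2 * ln n\<close>, and \<open>n \<le> k^3\<close> bounds
  \<open>n / k\<close> by \<open>n^(2/3)\<close>. The exponent is \<open>j - 1\<close> because the
  inequality records the state before the last star.\<close>

lemma greedy_rounds_le:
  fixes n k j :: nat
  assumes n: "n \<ge> 1" "n \<le> k ^ 3" "k \<le> n"
    and j: "j = 0 \<or> 1 \<le> real n ^ 2 * (1 - real k / real n) ^ (j - 1)"
  shows "real j \<le> 1 + 2 * real n powr (2 / 3) * ln (real n)"
proof (cases "j = 0")
  case False
  have k: "k > 0"
    using n by (cases k) auto
  have "0 \<le> 1 - real k / real n"
    using n by simp
  then have "(1 - real k / real n) ^ (j - 1) \<le> exp (- (real k / real n)) ^ (j - 1)"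
    using exp_ge_add_one_self[of "- (real k / real n)"] by (intro power_mono) auto
  also have "\<dots> = exp (- (real (j - 1) * (real k / real n)))"
    by (simp flip: exp_of_nat_mult)
  finally have "1 \<le> real n ^ 2 * exp (- (real (j - 1) * (real k / real n)))"
    using j False by (smt (verit, best) mult_left_mono zero_le_power2)
  then have "ln 1 \<le> ln (real n ^ 2 * exp (- (real (j - 1) * (real k / real n))))"
    using n by (subst ln_le_cancel_iff) auto
  also have "\<dots> = 2 * ln (real n) - real (j - 1) * (real k / real n)"
    using n by (simp add: ln_mult ln_realpow)
  finally have 1: "real (j - 1) * (real k / real n) \<le> 2 * ln (real n)"
    by simp
  have "real n powr (1 / 3) \<le> (real k ^ 3) powr (1 / 3)"
    using n(2) by (intro powr_mono2) (auto simp flip: of_nat_power)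
  also have "\<dots> = real k"
    using k by (simp flip: powr_numeral add: powr_powr)
  finally have "real n powr (1 / 3) \<le> real k" .
  then have "real (j - 1) * (real n powr (1 / 3) / real n) \<le> real (j - 1) * (real k / real n)"
    by (intro mult_left_mono divide_right_mono) auto
  moreover have "real n powr (1 / 3) / real n = 1 / real n powr (2 / 3)"
  proof -
    have "real n powr (1 / 3) * real n powr (2 / 3) = real n"
      using n by (simp flip: powr_add)
    then show ?thesis
      using n by (simp add: field_simps)
  qed
  ultimately have "real (j - 1) / real n powr (2 / 3) \<le> 2 * ln (real n)"
    using 1 by simp
  then have "real (j - 1) \<le> 2 * real n powr (2 / 3) * ln (real n)"
    using n by (simp add: field_simps)
  then show ?thesis
    using False by simp
qed (use n in simp)

text \<open>A nonzero \<open>k\<close> is at most 1 plus the cube root of \<open>n\<close>, and that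
  root is at least 1, so \<open>k\<close> is at most twice the root; squaring gives the 4.\<close>

lemma square_threshold_le:
  fixes n k :: nat
  assumes "n \<ge> 1" "k = 0 \<or> (k - 1) ^ 3 < n"
  shows "real (k ^ 2) \<le> 4 * real n powr (2 / 3)"
proof (cases "k = 0")
  case False
  have "real (k - 1) = (real (k - 1) ^ 3) powr (1 / 3)"
    by (cases "k = 1") (simp_all flip: powr_numeral add: powr_powr)
  also have "\<dots> \<le> real n powr (1 / 3)"
  proof (intro powr_mono2)
    show "real (k - 1) ^ 3 \<le> real n"
      using assms(2) False by (metis less_imp_le of_nat_le_iff of_nat_power)
  qed auto
  finally have "real k \<le> 1 + real n powr (1 / 3)"
    using False by simp
  moreover have "1 \<le> real n powr (1 / 3)"
    using assms(1) by (simp add: ge_one_powr_ge_zero)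
  ultimately have "real k \<le> 2 * real n powr (1 / 3)"
    by simp
  then have "real k ^ 2 \<le> (2 * real n powr (1 / 3)) ^ 2"
    by (intro power_mono) auto
  also have "\<dots> = 4 * real n powr (2 / 3)"
    using assms(1) by (simp add: power_mult_distrib flip: powr_numeral) (simp add: powr_powr)
  finally show ?thesis
    by simp
qed simp

section \<open>The program\<close>

definition safe_at :: "nat \<Rightarrow> (nat \<Rightarrow> nat) \<Rightarrow> nat \<Rightarrow> nat set" where
  "safe_at n f p = {w. w < n \<and> 0 < f (p * n + w)}"

definition ready :: "nat \<Rightarrow> nat \<Rightarrow> (vname \<Rightarrow> nat) \<Rightarrow> bool" where
  "ready n k v \<longleftrightarrow> v ''n'' = n \<and> v ''m'' = n * n \<and> v ''k'' = k"

text \<open>The input and everything the program stores in arrays are bits, so array reads are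
  always bounded.\<close>

definition zero_one :: "(vname \<Rightarrow> nat \<Rightarrow> nat) \<Rightarrow> bool" where
  "zero_one a \<longleftrightarrow> (\<forall>A i. a A i \<le> 1)"

definition Equal :: "aexp \<Rightarrow> aexp \<Rightarrow> bexp" where
  "Equal e f = Conj (Neg (Less e f)) (Neg (Less f e))"

definition Pos :: "aexp \<Rightarrow> bexp" where
  "Pos e = Less (Const 0) e"

text \<open>If \<open>p\<close> encodes the pair \<open>(u, v)\<close>, then
  \<open>p * n + w\<close> is the cell that the input format assigns to \<open>u\<close>,
  \<open>v\<close> and \<open>w\<close>.\<close>

definition Safe :: "aexp \<Rightarrow> aexp \<Rightarrow> bexp" where
  "Safe p w = Pos (Arr ''S'' (Plus (Times p (Var ''n'')) w))"

definition Fst :: "aexp \<Rightarrow> aexp" where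
  "Fst p = Div p (Var ''n'')"

text \<open>This is the remainder, for which the machine has no operation. The product inside is at
  most \<open>p\<close>, so no larger value arises.\<close>

definition Snd :: "aexp \<Rightarrow> aexp" where
  "Snd p = Minus p (Times (Var ''n'') (Div p (Var ''n'')))"

lemmas expr_defs = Equal_def Pos_def Safe_def Fst_def Snd_def

text \<open>A number \<open>p < n * n\<close> encodes the pair \<open>(p div n, p mod n)\<close>. Cell \<open>p\<close> of array \<open>H\<close> is set once
  the pair needs no further star, either because its safe set is small or because it is hit by a
  chosen centre; \<open>R\<close> marks the vertices reached from the first component of the current pair.\<close>

definition Threshold :: com where
  "Threshold = For ''t'' ''n''
     (Cond (Less (Times (Times (Var ''k'') (Var ''k'')) (Var ''k'')) (Var ''n''))
       (Assign ''k'' (Plus (Var ''k'') (Const 1))) SKIP)"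

definition Exclude_Small :: com where
  "Exclude_Small = For ''p'' ''m''
     (Seq (Count ''w'' ''n'' (Safe (Var ''p'') (Var ''w'')))
       (Cond (Less (Var ''c'') (Var ''k'')) (Store ''H'' (Var ''p'') (Const 1)) SKIP))"

definition Most_Frequent :: com where
  "Most_Frequent = Seq (Assign ''b'' (Const 0)) (Seq (Assign ''z'' (Const 0))
     (For ''w'' ''n''
       (Seq (Count ''p'' ''m''
              (Conj (Neg (Pos (Arr ''H'' (Var ''p'')))) (Safe (Var ''p'') (Var ''w''))))
         (Cond (Less (Var ''b'') (Var ''c''))
           (Seq (Assign ''b'' (Var ''c'')) (Assign ''z'' (Var ''w''))) SKIP))))"

text \<open>The nested negations form a disjunction. Both orientations of each star edge are marked,
  which keeps \<open>F\<close> symmetric.\<close>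

definition Add_Star :: com where
  "Add_Star = Seq
     (Mark ''q'' ''m'' (Neg (Conj (Neg (Equal (Fst (Var ''q'')) (Var ''z'')))
                                  (Neg (Equal (Snd (Var ''q'')) (Var ''z''))))) ''F'' 1)
     (Mark ''p'' ''m'' (Safe (Var ''p'') (Var ''z'')) ''H'' 1)"

text \<open>\<open>n * n\<close> rounds suffice because a round with \<open>b > 0\<close> covers at
  least one further pair; once \<open>b\<close> is 0 the remaining rounds idle.\<close>

definition Add_Stars :: com where
  "Add_Stars = For ''t'' ''m'' (Seq Most_Frequent (Cond (Pos (Var ''b'')) Add_Star SKIP))"

text \<open>Relaxation of all potential links in rounds, in the manner of Bellman and Ford; the
  first loop, whose guard is always true, clears \<open>R\<close>. There are as many rounds as
  potential links, which bounds the length of the walks that have to be followed.\<close>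

definition Search :: com where
  "Search = Seq (Mark ''x'' ''n'' (Less (Const 0) (Const 1)) ''R'' 0)
     (Seq (Store ''R'' (Fst (Var ''p'')) (Const 1))
       (For ''t'' ''m'' (For ''q'' ''m''
         (Cond (Conj (Pos (Arr ''F'' (Var ''q'')))
                 (Conj (Conj (Safe (Var ''p'') (Fst (Var ''q''))) (Safe (Var ''p'') (Snd (Var ''q''))))
                   (Pos (Arr ''R'' (Fst (Var ''q''))))))
           (Store ''R'' (Snd (Var ''q'')) (Const 1)) SKIP))))"

definition Add_Cliques :: com where
  "Add_Cliques = For ''p'' ''m'' (Seq Search
     (Cond (Pos (Arr ''R'' (Snd (Var ''p'')))) SKIP
       (Mark ''q'' ''m'' (Conj (Safe (Var ''p'') (Fst (Var ''q''))) (Safe (Var ''p'') (Snd (Var ''q''))))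
         ''F'' 1)))"

definition Connect :: com where
  "Connect = Seq (Assign ''m'' (Times (Var ''n'') (Var ''n'')))
     (Seq Threshold (Seq Exclude_Small (Seq Add_Stars Add_Cliques)))"

section \<open>The threshold and the removal of small safe sets\<close>

lemma index_le_value_bound:
  assumes "n \<ge> 1" "p < n * n" "w \<le> n"
  shows "p * n \<le> value_bound n" "p * n + w \<le> value_bound n"
proof -
  have "p * n \<le> n * n * n"
    using assms by (intro mult_le_mono1) auto
  moreover have "n \<le> n * n * n"
    using assms(1) by simp
  ultimately show "p * n \<le> value_bound n" "p * n + w \<le> value_bound n"
    using assms(3) unfolding value_bound_def power3_eq_cube by linarith+
qed

lemma zero_one_le: "zero_one a \<Longrightarrow> a A i \<le> Suc 0"
  by (simp add: zero_one_def)

lemma zero_one_upd: "zero_one a \<Longrightarrow> (\<And>i. f i \<le> Suc 0) \<Longrightarrow> zero_one (a(A := f))"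
  by (simp add: zero_one_def)

lemma bounded_Safe:
  assumes "n \<ge> 1" "v ''n'' = n" "zero_one a" "abounded (value_bound n) e (mem v a)"
    "abounded (value_bound n) f (mem v a)" "aval e (mem v a) < n * n" "aval f (mem v a) \<le> n"
  shows "bbounded (value_bound n) (Safe e f) (mem v a)"
  using assms index_le_value_bound[OF assms(1), of "aval e (mem v a)"]
    value_bound_simps[OF assms(1)] le_trans[OF zero_one_le[OF assms(3)]]
  by (auto simp: expr_defs)

lemma loop_n: "n = (if ''n'' = ''m'' then n * n else n)"
  by simp

lemma loop_m: "n * n = (if ''m'' = ''m'' then n * n else n)"
  by simp

lemma wp_Threshold:
  assumes n: "n \<ge> 1" and v: "v ''n'' = n" "v ''m'' = n * n" "v ''k'' = 0"
    and Q: "\<And>k v. k \<le> n \<Longrightarrow> n \<le> k ^ 3 \<Longrightarrow> k = 0 \<or> (k - 1) ^ 3 < n \<Longrightarrow> ready n k v \<Longrightarrow> Q v a"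
  shows "wp n Threshold Q v a"
proof -
  \<comment> \<open>Either \<open>k\<close> has grown in every round so far or it has reached its
    goal. The last conjunct records that the latest increment was necessary.\<close>
  let ?I = "\<lambda>i v' a'. a' = a \<and> ready n (v' ''k'') v' \<and> v' ''k'' \<le> i \<and>
    (i \<le> v' ''k'' \<or> n \<le> v' ''k'' ^ 3) \<and> (v' ''k'' = 0 \<or> (v' ''k'' - 1) ^ 3 < n)"
  show ?thesis
    unfolding Threshold_def
  proof (rule wp_For[OF n loop_n, where I = ?I])
    fix i v' a' assume i: "i < n" "v' ''t'' = i" and I: "?I i v' a'"
    have n': "v' ''n'' = n" "v' ''m'' = n * n"
      using I by (simp_all add: ready_def)
    define k where "k = v' ''k''"
    have k: "k \<le> n"
      using I i by (simp add: k_def)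
    then have "k * k \<le> n * n" "k * k * k \<le> n * n * n"
      by (auto intro!: mult_le_mono)
    then have kkk: "k * k \<le> value_bound n" "k * k * k \<le> value_bound n"
      using value_bound_simps(3)[OF n] le_trans by (blast, simp add: value_bound_def power3_eq_cube)
    show "wp n (Cond (Less (Times (Times (Var ''k'') (Var ''k'')) (Var ''k'')) (Var ''n''))
          (Assign ''k'' (Plus (Var ''k'') (Const 1))) SKIP)
        (\<lambda>v a. v ''t'' = i \<and> ?I (Suc i) (v(''t'' := Suc i)) a) v' a'"
    proof (intro wp_Cond wp_Assign wp_SKIP)
      show "bbounded (value_bound n)
          (Less (Times (Times (Var ''k'') (Var ''k'')) (Var ''k'')) (Var ''n'')) (mem v' a')"
        using kkk n' k value_bound_simps[OF n] by (auto simp flip: k_def)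
      show "abounded (value_bound n) (Plus (Var ''k'') (Const 1)) (mem v' a')"
        using i k I value_bound_simps[OF n] by (auto simp flip: k_def)
    next
      assume "bval (Less (Times (Times (Var ''k'') (Var ''k'')) (Var ''k'')) (Var ''n'')) (mem v' a')"
      then have "k ^ 3 < n"
        using n' by (simp add: power3_eq_cube k_def)
      moreover from this have "i \<le> k"
        using I by (auto simp: k_def)
      ultimately show "(v'(''k'' := aval (Plus (Var ''k'') (Const 1)) (mem v' a'))) ''t'' = i \<and>
          ?I (Suc i) (v'(''k'' := aval (Plus (Var ''k'') (Const 1)) (mem v' a'), ''t'' := Suc i)) a'"
        using I i n' by (auto simp: k_def ready_def)
    next
      assume "\<not> bval (Less (Times (Times (Var ''k'') (Var ''k'')) (Var ''k'')) (Var ''n'')) (mem v' a')"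
      then have "n \<le> k ^ 3"
        using n' by (simp add: power3_eq_cube k_def)
      then show "v' ''t'' = i \<and> ?I (Suc i) (v'(''t'' := Suc i)) a'"
        using I i n' by (auto simp: k_def ready_def)
    qed auto
  next
    fix v' a' assume I: "?I n v' a'"
    have "n \<le> v' ''k'' ^ 3"
    proof (cases "n \<le> v' ''k'' ^ 3")
      case False
      \<comment> \<open>Here \<open>k\<close> has grown in all \<open>n\<close> rounds, and
        \<open>n\<close> itself is large enough.\<close>
      then have "n \<le> v' ''k''"
        using I by simp
      also have "\<dots> \<le> v' ''k'' ^ 3"
        by (simp add: power3_eq_cube)
      finally show ?thesis .
    qed simp
    then show "Q v' a'"
      using Q[of "v' ''k''" v'] I by auto
  qed (use v in \<open>auto simp: ready_def\<close>)
qed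

lemma wp_Exclude_Small:
  assumes n: "n \<ge> 1" "k \<le> n" and v: "ready n k v" and a: "zero_one a" "a ''H'' = (\<lambda>_. 0)"
    and Q: "\<And>v'. ready n k v' \<Longrightarrow>
      Q v' (a(''H'' := (\<lambda>p. of_bool (p < n * n \<and> card (safe_at n (a ''S'') p) < k))))"
  shows "wp n Exclude_Small Q v a"
proof -
  let ?H = "\<lambda>i. a(''H'' := (\<lambda>p. of_bool (p < i \<and> card (safe_at n (a ''S'') p) < k)))"
  let ?I = "\<lambda>i v' a'. ready n k v' \<and> a' = ?H i"
  show ?thesis
    unfolding Exclude_Small_def
  proof (rule wp_For[OF n(1) loop_m, where I = ?I])
    fix i v' a' assume i: "i < n * n" "v' ''p'' = i" and I: "?I i v' a'"
    have n': "v' ''n'' = n"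
      using I by (simp add: ready_def)
    have bin: "zero_one a'"
      using I a by (auto intro!: zero_one_upd)
    let ?c = "card {w. w < n \<and> w \<in> safe_at n (a ''S'') i}"
    have c: "?c = card (safe_at n (a ''S'') i)"
      by (rule arg_cong[of _ _ card]) (auto simp: safe_at_def)
    have c_le: "?c \<le> value_bound n"
      by (rule le_trans[OF card_less_le value_bound_simps(2)[OF n(1)]])
    show "wp n (Seq (Count ''w'' ''n'' (Safe (Var ''p'') (Var ''w'')))
        (Cond (Less (Var ''c'') (Var ''k'')) (Store ''H'' (Var ''p'') (Const 1)) SKIP))
        (\<lambda>v a. v ''p'' = i \<and> ?I (Suc i) (v(''p'' := Suc i)) a) v' a'"
    proof (intro wp_Seq wp_Count[OF n(1) loop_n, where P = "\<lambda>w. w \<in> safe_at n (a ''S'') i"])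
      fix w c assume w: "w < n"
      show "bbounded (value_bound n) (Safe (Var ''p'') (Var ''w'')) (mem (v'(''c'' := c, ''w'' := w)) a') \<or> w < c"
        using w i n' bin value_bound_simps[OF n(1)]
        by (intro disjI1 bounded_Safe[OF n(1)]) auto
      show "bval (Safe (Var ''p'') (Var ''w'')) (mem (v'(''c'' := c, ''w'' := w)) a') \<longleftrightarrow>
          w \<in> safe_at n (a ''S'') i"
        using w i n' I by (auto simp: safe_at_def expr_defs)
    next
      show "wp n (Cond (Less (Var ''c'') (Var ''k'')) (Store ''H'' (Var ''p'') (Const 1)) SKIP)
          (\<lambda>v a. v ''p'' = i \<and> ?I (Suc i) (v(''p'' := Suc i)) a)
          (v'(''c'' := card {j. j < n \<and> j \<in> safe_at n (a ''S'') i},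
              ''w'' := n)) a'"
        using c c_le I i n value_bound_simps[OF n(1)]
        by (intro wp_Cond wp_Store wp_SKIP) (auto simp: ready_def fun_eq_iff less_Suc_eq)
    qed (use n' in \<open>auto simp: expr_defs\<close>)
  next
    fix v' a' assume "v' ''p'' = (n * n)"
      "?I (n * n) v' a'"
    then show "Q v' a'"
      using Q by simp
  qed (use v a in \<open>auto simp: ready_def fun_eq_iff\<close>)
qed

section \<open>Greedy covering by stars\<close>

definition uncovered :: "nat \<Rightarrow> (nat \<Rightarrow> nat) \<Rightarrow> nat set" where
  "uncovered n h = {p. p < n * n \<and> h p = 0}"

lemma finite_uncovered [simp]: "finite (uncovered n h)"
  by (simp add: uncovered_def)

lemma wp_Most_Frequent:
  assumes n: "n \<ge> 1" "k \<le> n" and v: "ready n k v" and a: "zero_one a"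
    and Q: "\<And>v'. ready n k v' \<Longrightarrow> v' ''t'' = v ''t'' \<Longrightarrow> v' ''z'' < n \<Longrightarrow> v' ''b'' \<le> n * n \<Longrightarrow>
      v' ''b'' = card {p \<in> uncovered n (a ''H''). v' ''z'' \<in> safe_at n (a ''S'') p} \<Longrightarrow>
      (\<And>w. w < n \<Longrightarrow> card {p \<in> uncovered n (a ''H''). w \<in> safe_at n (a ''S'') p} \<le> v' ''b'') \<Longrightarrow> Q v' a"
  shows "wp n Most_Frequent Q v a"
proof -
  define cnt where "cnt w = card {p \<in> uncovered n (a ''H''). w \<in> safe_at n (a ''S'') p}" for w
  have cnt_eq: "cnt w = card {p. p < n * n \<and> (a ''H'' p = 0 \<and> w \<in> safe_at n (a ''S'') p)}" for w
    unfolding cnt_def uncovered_def by (rule arg_cong[of _ _ card]) auto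
  have cnt_le: "cnt w \<le> n * n" for w
    unfolding cnt_eq by (rule card_less_le)
  then have cnt_le': "cnt w \<le> value_bound n" for w
    using value_bound_simps(3)[OF n(1)] le_trans by blast
  \<comment> \<open>While \<open>b\<close> is 0, \<open>z\<close> carries no information yet, hence
    the disjunction.\<close>
  let ?I = "\<lambda>i v' a'. a' = a \<and> ready n k v' \<and> v' ''t'' = v ''t'' \<and> v' ''z'' < n \<and>
    v' ''b'' \<le> n * n \<and> (v' ''b'' = 0 \<or> v' ''b'' = cnt (v' ''z'')) \<and> (\<forall>w<i. cnt w \<le> v' ''b'')"
  show ?thesis
    unfolding Most_Frequent_def
  proof (intro wp_Seq wp_Assign wp_For[OF n(1) loop_n, where I = ?I])
    fix i v' a' assume i: "i < n" "v' ''w'' = i" and I: "?I i v' a'"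
    have v': "v' ''n'' = n" "v' ''m'' = n * n"
      using I by (auto simp: ready_def)
    have b: "v' ''b'' \<le> value_bound n"
      using I value_bound_simps(3)[OF n(1)] le_trans by blast
    show "wp n (Count ''p'' ''m''
          (Conj (Neg (Pos (Arr ''H'' (Var ''p'')))) (Safe (Var ''p'') (Var ''w''))))
        (wp n (Cond (Less (Var ''b'') (Var ''c''))
           (Seq (Assign ''b'' (Var ''c'')) (Assign ''z'' (Var ''w''))) SKIP)
          (\<lambda>v a. v ''w'' = i \<and> ?I (Suc i) (v(''w'' := Suc i)) a)) v' a'"
    proof (intro wp_Count[OF n(1) loop_m, where P = "\<lambda>p. a ''H'' p = 0 \<and> i \<in> safe_at n (a ''S'') p"])
      fix p c assume p: "p < n * n"
      show "bbounded (value_bound n) (Conj (Neg (Pos (Arr ''H'' (Var ''p'')))) (Safe (Var ''p'') (Var ''w'')))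
          (mem (v'(''c'' := c, ''p'' := p)) a') \<or> p < c"
        using p i v' I a zero_one_le[OF a, of "''H''"] value_bound_simps[OF n(1)]
          bounded_Safe[OF n(1), of "v'(''c'' := c, ''p'' := p)" a "Var ''p''" "Var ''w''"]
          le_trans[OF zero_one_le[OF a]]
        by (auto simp: Pos_def)
      show "bval (Conj (Neg (Pos (Arr ''H'' (Var ''p'')))) (Safe (Var ''p'') (Var ''w'')))
          (mem (v'(''c'' := c, ''p'' := p)) a') \<longleftrightarrow> a ''H'' p = 0 \<and> i \<in> safe_at n (a ''S'') p"
        using i v' I by (auto simp: safe_at_def expr_defs)
    next
      show "wp n (Cond (Less (Var ''b'') (Var ''c''))
           (Seq (Assign ''b'' (Var ''c'')) (Assign ''z'' (Var ''w''))) SKIP)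
          (\<lambda>v a. v ''w'' = i \<and> ?I (Suc i) (v(''w'' := Suc i)) a)
          (v'(''c'' := card {j. j < n * n \<and> a ''H'' j = 0 \<and> i \<in> safe_at n (a ''S'') j}, ''p'' := n * n)) a'"
        unfolding cnt_eq[symmetric]
        using b cnt_le' cnt_le i I n value_bound_simps[OF n(1)]
        by (intro wp_Cond wp_Seq wp_Assign wp_SKIP) (auto simp: ready_def less_Suc_eq intro: less_imp_le le_trans)
    qed (use v' in \<open>auto simp: expr_defs\<close>)
  next
    fix v' a' assume I: "?I n v' a'"
    \<comment> \<open>If \<open>b\<close> is 0, then all counts are 0, among them that of
      \<open>z < n\<close>, so the second alternative holds anyway.\<close>
    then have "v' ''b'' = cnt (v' ''z'')"
      by force
    then show "Q v' a'"
      using Q[of v'] I unfolding cnt_def by blast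
  qed (use n v in \<open>auto simp: ready_def\<close>)
qed

lemma index_less:
  assumes "x < n" "y < (n :: nat)"
  shows "x * n + y < n * n"
proof -
  have "x * n + y < Suc x * n"
    using assms by simp
  also have "\<dots> \<le> n * n"
    using assms by (intro mult_le_mono1) simp
  finally show ?thesis .
qed

lemma div_less_square: "q < n * n \<Longrightarrow> q div n < (n :: nat)"
  by (simp add: less_mult_imp_div_less)

lemma aval_Fst [simp]: "aval (Fst e) s = aval e s div var s ''n''"
  by (simp add: Fst_def)

lemma aval_Snd [simp]: "aval (Snd e) s = aval e s mod var s ''n''"
  by (simp add: Snd_def minus_mult_div_eq_mod)

lemma abounded_Fst [simp]: "abounded M (Fst e) s \<longleftrightarrow> abounded M e s \<and> var s ''n'' \<le> M"
  by (simp add: Fst_def)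

lemma abounded_Snd [simp]: "abounded M (Snd e) s \<longleftrightarrow> abounded M e s \<and> var s ''n'' \<le> M"
proof (cases "abounded M e s")
  case True
  then have "var s ''n'' * (aval e s div var s ''n'') \<le> M"
    using aval_le[OF True] by (meson le_trans times_div_less_eq_dividend)
  then show ?thesis
    using True by (auto simp: Snd_def)
qed (simp add: Snd_def)

lemma size_exprs [simp]:
  "asize (Fst e) = asize e + 3" "asize (Snd e) = 2 * asize e + 8"
  "bsize (Pos e) = asize e + 3" "bsize (Equal e f) = 2 * asize e + 2 * asize f + 7"
  "bsize (Safe e f) = asize e + asize f + 10"
  by (simp_all add: expr_defs)

lemma bval_Pos [simp]: "bval (Pos e) s \<longleftrightarrow> 0 < aval e s"
  by (simp add: Pos_def)

lemma bbounded_Pos [simp]: "bbounded M (Pos e) s \<longleftrightarrow> abounded M e s"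
  by (simp add: Pos_def)

lemma bval_Equal [simp]: "bval (Equal e f) s \<longleftrightarrow> aval e s = aval f s"
  by (auto simp: Equal_def)

lemma bbounded_Equal [simp]: "bbounded M (Equal e f) s \<longleftrightarrow> abounded M e s \<and> abounded M f s"
  by (auto simp: Equal_def)

lemma bval_Safe:
  assumes "aval e s < var s ''n'' * var s ''n''" "aval f s < var s ''n''"
  shows "bval (Safe e f) s \<longleftrightarrow> aval f s \<in> safe_at (var s ''n'') (arr s ''S'') (aval e s)"
  using assms by (simp add: Safe_def safe_at_def)

lemma links_mark:
  "links n (\<lambda>q. if q < n * n \<and> P (q div n) (q mod n) then 1 else f q) =
     links n f \<union> {(x, y). x < n \<and> y < n \<and> P x y}"
  using index_less[of _ n] by (auto simp: links_def)

lemma wp_Add_Star: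
  assumes n: "n \<ge> 1" "k \<le> n" and v: "ready n k v" "v ''z'' = z" "z < n" and a: "zero_one a"
    and Q: "\<And>v' a' f h. a' = a(''F'' := f, ''H'' := h) \<Longrightarrow> ready n k v' \<Longrightarrow> v' ''t'' = v ''t'' \<Longrightarrow> zero_one a' \<Longrightarrow>
      links n f = links n (a ''F'') \<union> star n z \<Longrightarrow>
      uncovered n h = {p \<in> uncovered n (a ''H''). z \<notin> safe_at n (a ''S'') p} \<Longrightarrow> Q v' a'"
  shows "wp n Add_Star Q v a"
  unfolding Add_Star_def
proof (intro wp_Seq)
  let ?f = "\<lambda>q. if q < n * n \<and> (q div n = z \<or> q mod n = z) then 1 else a ''F'' q"
  let ?h = "\<lambda>q. if q < n * n \<and> z \<in> safe_at n (a ''S'') q then 1 else a ''H'' q"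
  have v': "v ''n'' = n" "v ''m'' = n * n"
    using v by (auto simp: ready_def)
  note bd = value_bound_simps[OF n(1)]
  have bin: "zero_one (a(''F'' := ?f))"
    using zero_one_le[OF a] by (intro zero_one_upd[OF a]) auto
  have bin2: "zero_one (a(''F'' := ?f, ''H'' := ?h))"
    using zero_one_le[OF a] by (intro zero_one_upd[OF bin]) auto
  show "wp n (Mark ''q'' ''m'' (Neg (Conj (Neg (Equal (Fst (Var ''q'')) (Var ''z'')))
                                  (Neg (Equal (Snd (Var ''q'')) (Var ''z''))))) ''F'' 1)
     (wp n (Mark ''p'' ''m'' (Safe (Var ''p'') (Var ''z'')) ''H'' 1) Q) v a"
  proof (rule wp_Mark[OF n(1) loop_m, where P = "\<lambda>q. q div n = z \<or> q mod n = z"])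
    show "wp n (Mark ''p'' ''m'' (Safe (Var ''p'') (Var ''z'')) ''H'' 1) Q (v(''q'' := n * n)) (a(''F'' := ?f))"
    proof (rule wp_Mark[OF n(1) loop_m, where P = "\<lambda>p. z \<in> safe_at n (a ''S'') p"])
      fix i :: nat and g :: "nat \<Rightarrow> nat"
      assume i: "i < n * n"
      show "bval (Safe (Var ''p'') (Var ''z'')) (mem (v(''q'' := n * n, ''p'' := i)) (a(''F'' := ?f, ''H'' := g)))
          \<longleftrightarrow> z \<in> safe_at n (a ''S'') i"
        using i v v' by (subst bval_Safe) auto
      assume g: "\<And>j. g j \<le> 1"
      show "bbounded (value_bound n) (Safe (Var ''p'') (Var ''z''))
          (mem (v(''q'' := n * n, ''p'' := i)) (a(''F'' := ?f, ''H'' := g)))"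
        using i v v' bd g by (intro bounded_Safe[OF n(1)] zero_one_upd[OF bin]) auto
    next
      have eq: "(a(''F'' := ?f))(''H'' :=
          (\<lambda>i. if i < n * n \<and> z \<in> safe_at n (a ''S'') i then 1 else (a(''F'' := ?f)) ''H'' i)) =
          a(''F'' := ?f, ''H'' := ?h)"
        by (auto simp: fun_eq_iff)
      show "Q (v(''q'' := n * n, ''p'' := n * n)) ((a(''F'' := ?f))(''H'' :=
          (\<lambda>i. if i < n * n \<and> z \<in> safe_at n (a ''S'') i then 1 else (a(''F'' := ?f)) ''H'' i)))"
        unfolding eq
      proof (rule Q[OF refl _ _ bin2])
        show "links n ?f = links n (a ''F'') \<union> star n z"
          unfolding links_mark[of n "\<lambda>x y. x = z \<or> y = z"] by (simp add: star_def)
        show "uncovered n ?h = {p \<in> uncovered n (a ''H''). z \<notin> safe_at n (a ''S'') p}"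
          by (auto simp: uncovered_def)
      qed (use v in \<open>auto simp: ready_def\<close>)
    qed (use v' zero_one_le[OF a] in auto)
  qed (use v v' bd zero_one_le[OF a] in \<open>auto intro: less_imp_le less_le_trans\<close>)
qed

text \<open>The last conjunct bounds the number \<open>j\<close> of stars: every star covers at least a \<open>k / n\<close> fraction
  of the uncovered pairs, and a star is added only while some pair is uncovered.\<close>

definition star_phase ::
  "nat \<Rightarrow> nat \<Rightarrow> (nat \<Rightarrow> nat set) \<Rightarrow> (nat \<Rightarrow> nat) \<Rightarrow> (nat \<Rightarrow> nat) \<Rightarrow> bool" where
  "star_phase n k A f h \<longleftrightarrow> sym (links n f) \<and>
     (\<forall>p<n * n. k \<le> card (A p) \<longrightarrow> h p = 0 \<or> (\<exists>w\<in>A p. star n w \<subseteq> links n f)) \<and>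
     (\<forall>p\<in>uncovered n h. k \<le> card (A p)) \<and>
     (\<exists>j. card (undirected (links n f)) \<le> n * j \<and>
        real (card (uncovered n h)) \<le> real n ^ 2 * (1 - real k / real n) ^ j \<and>
        (j = 0 \<or> 1 \<le> real n ^ 2 * (1 - real k / real n) ^ (j - 1)))"

lemma star_phase_init:
  "star_phase n k A (\<lambda>_. 0) (\<lambda>p. of_bool (p < n * n \<and> card (A p) < k))"
proof -
  let ?h = "\<lambda>p. of_bool (p < n * n \<and> card (A p) < k) :: nat"
  have "card (uncovered n ?h) \<le> n * n"
    unfolding uncovered_def by (rule card_less_le)
  then have "real (card (uncovered n ?h)) \<le> real n ^ 2"
    unfolding power2_eq_square by (metis of_nat_le_iff of_nat_mult)
  moreover have "links n (\<lambda>_. 0) = {}"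
    by (simp add: links_def)
  ultimately show ?thesis
    unfolding star_phase_def
    by (auto simp: sym_def undirected_def uncovered_def intro!: exI[of _ 0])
qed

text \<open>By double counting, the maximal frequency \<open>b\<close> is at least a
  \<open>k / n\<close> fraction of the uncovered pairs, so at most a \<open>1 - k / n\<close>
  fraction remains; the star adds at most \<open>n\<close> edges. Hence \<open>Suc j\<close>
  witnesses the new invariant.\<close>

lemma star_phase_step:
  assumes inv: "star_phase n k A f h" and n: "n \<ge> 1" "k \<le> n"
    and A: "\<And>p. A p \<subseteq> {..<n}"
    and b: "b = card {p \<in> uncovered n h. z \<in> A p}" "b > 0"
    and b_max: "\<And>w. w < n \<Longrightarrow> card {p \<in> uncovered n h. w \<in> A p} \<le> b"
    and f': "links n f' = links n f \<union> star n z"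
    and h': "uncovered n h' = {p \<in> uncovered n h. z \<notin> A p}"
  shows "star_phase n k A f' h'" "card (uncovered n h') < card (uncovered n h)"
proof -
  let ?U = "uncovered n h" and ?x = "1 - real k / real n"
  have card_U': "card (uncovered n h') = card ?U - b"
  proof -
    have "uncovered n h' = ?U - {p \<in> ?U. z \<in> A p}"
      using h' by auto
    then show ?thesis
      using b by (simp add: card_Diff_subset)
  qed
  have b_le: "b \<le> card ?U"
    unfolding b by (rule card_mono) auto
  then show less: "card (uncovered n h') < card ?U"
    using card_U' b by simp
  have "k * card ?U \<le> n * b"
    using inv A b_max by (intro exists_frequent_element[of _ A]) (auto simp: star_phase_def)
  then have "real k * card ?U \<le> real n * b"
    by (metis of_nat_le_iff of_nat_mult)
  then have "real (card (uncovered n h')) \<le> card ?U * ?x"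
    using n b_le by (simp add: card_U' of_nat_diff field_simps)
  moreover obtain j where j: "card (undirected (links n f)) \<le> n * j"
    "real (card ?U) \<le> real n ^ 2 * ?x ^ j"
    using inv by (auto simp: star_phase_def)
  have x: "?x \<ge> 0"
    using n by simp
  ultimately have "real (card (uncovered n h')) \<le> real n ^ 2 * ?x ^ Suc j"
    using mult_right_mono[OF j(2) x] by (simp add: mult_ac)
  \<comment> \<open>As \<open>b > 0\<close>, some pair was uncovered before this star, so the bound
    belonging to \<open>j\<close> is at least 1; for \<open>Suc j\<close> this is the clause with
    exponent \<open>Suc j - 1\<close>.\<close>
  moreover have "1 \<le> real n ^ 2 * ?x ^ j"
    using j(2) b_le b(2) by linarith
  moreover have "card (undirected (links n f')) \<le> n * Suc j"
    using card_Un_le[of "undirected (links n f)" "undirected (star n z)"] j(1)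
      card_undirected_star[of n z] by (simp add: f' undirected_Un)
  ultimately have "\<exists>j. card (undirected (links n f')) \<le> n * j \<and>
        real (card (uncovered n h')) \<le> real n ^ 2 * ?x ^ j \<and>
        (j = 0 \<or> 1 \<le> real n ^ 2 * ?x ^ (j - 1))"
    by (intro exI[of _ "Suc j"]) auto
  moreover have "sym (links n f')"
    using inv sym_star[of n z] unfolding f' by (auto simp: star_phase_def sym_def)
  moreover have "h' p = 0 \<or> (\<exists>w\<in>A p. star n w \<subseteq> links n f')" if p: "p < n * n" "k \<le> card (A p)" for p
  proof (cases "h p = 0")
    case True
    then show ?thesis
      using h' p unfolding f' by (auto simp: uncovered_def)
  next
    case False
    then obtain w where "w \<in> A p" "star n w \<subseteq> links n f"
      using inv p by (auto simp: star_phase_def)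
    then show ?thesis
      unfolding f' by blast
  qed
  ultimately show "star_phase n k A f' h'"
    using inv h' by (auto simp: star_phase_def)
qed

text \<open>If no vertex lies in the safe set of an uncovered pair, double counting gives
  \<open>k * card U \<le> 0\<close> for the set \<open>U\<close> of uncovered pairs. So a round can
  idle only when the covering is complete.\<close>

lemma star_phase_stop:
  assumes inv: "star_phase n k A f h" and "k \<ge> 1"
    and A: "\<And>p. A p \<subseteq> {..<n}"
    and "\<And>w. w < n \<Longrightarrow> card {p \<in> uncovered n h. w \<in> A p} \<le> 0"
  shows "card (uncovered n h) = 0"
proof -
  have "k * card (uncovered n h) \<le> n * 0"
    using inv A assms(4) by (intro exists_frequent_element[of _ A]) (auto simp: star_phase_def)
  then show ?thesis
    using assms(2) by simp
qed

lemma safe_at_subset: "safe_at n s p \<subseteq> {..<n}"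
  by (auto simp: safe_at_def)

lemma wp_Add_Stars:
  assumes n: "n \<ge> 1" "k \<le> n" "k \<ge> 1" and v: "ready n k v" and a: "zero_one a"
    and phase: "star_phase n k (safe_at n (a ''S'')) (a ''F'') (a ''H'')"
    and Q: "\<And>v' a' f h. a' = a(''F'' := f, ''H'' := h) \<Longrightarrow> ready n k v' \<Longrightarrow> zero_one a' \<Longrightarrow>
      star_phase n k (safe_at n (a ''S'')) f h \<Longrightarrow> uncovered n h = {} \<Longrightarrow> Q v' a'"
  shows "wp n Add_Stars Q v a"
proof -
  let ?A = "safe_at n (a ''S'')"
  \<comment> \<open>Each productive round removes at least one of the at most \<open>n * n\<close>
    uncovered pairs, so after \<open>n * n\<close> rounds both alternatives mean that none is
    left.\<close>
  let ?I = "\<lambda>i v' a'. ready n k v' \<and> zero_one a' \<and>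
    (\<exists>f h. a' = a(''F'' := f, ''H'' := h) \<and> star_phase n k ?A f h \<and>
      (card (uncovered n h) = 0 \<or> card (uncovered n h) + i \<le> n * n))"
  show ?thesis
    unfolding Add_Stars_def
  proof (rule wp_For[OF n(1) loop_m, where I = ?I])
    have "card (uncovered n (a ''H'')) \<le> n * n"
      unfolding uncovered_def by (rule card_less_le)
    then have "\<exists>f h. a = a(''F'' := f, ''H'' := h) \<and> star_phase n k ?A f h \<and>
        (card (uncovered n h) = 0 \<or> card (uncovered n h) + 0 \<le> n * n)"
      using phase by - (rule exI[of _ "a ''F''"], rule exI[of _ "a ''H''"], simp)
    then show "?I 0 (v(''t'' := 0)) a"
      using v a by (simp add: ready_def)
  next
    fix i v' a' assume i: "i < n * n" "v' ''t'' = i" and I: "?I i v' a'"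
    then obtain f h where fh: "a' = a(''F'' := f, ''H'' := h)" "star_phase n k ?A f h"
      "card (uncovered n h) = 0 \<or> card (uncovered n h) + i \<le> n * n"
      by blast
    have S: "a' ''S'' = a ''S''" "a' ''H'' = h" "a' ''F'' = f"
      using fh by simp_all
    show "wp n (Seq Most_Frequent (Cond (Pos (Var ''b'')) Add_Star SKIP))
        (\<lambda>v a. v ''t'' = i \<and> ?I (Suc i) (v(''t'' := Suc i)) a) v' a'"
    proof (intro wp_Seq wp_Most_Frequent[OF n(1,2)])
      fix w assume w: "ready n k w" "w ''t'' = v' ''t''" "w ''z'' < n" "w ''b'' \<le> n * n"
        "w ''b'' = card {p \<in> uncovered n (a' ''H''). w ''z'' \<in> safe_at n (a' ''S'') p}"
        "\<And>x. x < n \<Longrightarrow> card {p \<in> uncovered n (a' ''H''). x \<in> safe_at n (a' ''S'') p} \<le> w ''b''"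
      show "wp n (Cond (Pos (Var ''b'')) Add_Star SKIP)
          (\<lambda>v a. v ''t'' = i \<and> ?I (Suc i) (v(''t'' := Suc i)) a) w a'"
      proof (intro wp_Cond wp_SKIP)
        assume b: "bval (Pos (Var ''b'')) (mem w a')"
        show "wp n Add_Star (\<lambda>v a. v ''t'' = i \<and> ?I (Suc i) (v(''t'' := Suc i)) a) w a'"
        proof (intro wp_Add_Star[OF n(1,2) w(1) refl w(3)])
          fix v'' a'' f' h'
          assume *: "a'' = a'(''F'' := f', ''H'' := h')" "ready n k v''" "v'' ''t'' = w ''t''" "zero_one a''"
            "links n f' = links n (a' ''F'') \<union> star n (w ''z'')"
            "uncovered n h' = {p \<in> uncovered n (a' ''H''). w ''z'' \<notin> safe_at n (a' ''S'') p}"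
          have "star_phase n k ?A f' h'" "card (uncovered n h') < card (uncovered n h)"
            using star_phase_step[OF fh(2) n(1,2) safe_at_subset, of "w ''b''" "w ''z''" f' h']
              w b * S by auto
          moreover have "a'' = a(''F'' := f', ''H'' := h')"
            using * fh by auto
          moreover from calculation(2) have
            "card (uncovered n h') = 0 \<or> card (uncovered n h') + Suc i \<le> n * n"
            using fh(3) by linarith
          moreover have "v'' ''t'' = i" "ready n k (v''(''t'' := Suc i))"
            using * w i by (auto simp: ready_def)
          ultimately show "v'' ''t'' = i \<and> ?I (Suc i) (v''(''t'' := Suc i)) a''"
            using *(4) by blast
        qed (use I in auto)
      next
        assume "\<not> bval (Pos (Var ''b'')) (mem w a')"
        then have "w ''b'' = 0"
          by simp
        have "card (uncovered n h) = 0"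
        proof (rule star_phase_stop[OF fh(2) n(3) safe_at_subset])
          fix x assume "x < n"
          from w(6)[OF this] show "card {p \<in> uncovered n h. x \<in> safe_at n (a ''S'') p} \<le> 0"
            using \<open>w ''b'' = 0\<close> S by simp
        qed
        moreover have "w ''t'' = i" "ready n k (w(''t'' := Suc i))"
          using w i by (auto simp: ready_def)
        ultimately show "w ''t'' = i \<and> ?I (Suc i) (w(''t'' := Suc i)) a'"
          using I fh(1,2) by blast
      qed (use w(4) value_bound_simps(3)[OF n(1)] in \<open>auto simp: expr_defs\<close>)
    qed (use I in auto)
  next
    fix v' a' assume "?I (n * n) v' a'"
    then obtain f h where "a' = a(''F'' := f, ''H'' := h)" "star_phase n k ?A f h"
      "card (uncovered n h) = 0" "ready n k v'" "zero_one a'"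
      by auto
    then show "Q v' a'"
      using Q[of a' f h v'] by simp
  qed (auto simp: ready_def)
qed

section \<open>Reachability within a safe set\<close>

definition safe_links :: "nat \<Rightarrow> (nat \<Rightarrow> nat) \<Rightarrow> (nat \<Rightarrow> nat) \<Rightarrow> nat \<Rightarrow> (nat \<times> nat) set" where
  "safe_links n s f p = links n f \<inter> safe_at n s p \<times> safe_at n s p"

lemma finite_safe_links: "finite (safe_links n s f p)"
  by (simp add: safe_links_def)

lemma card_safe_links: "card (safe_links n s f p) \<le> n * n"
proof -
  have "safe_links n s f p \<subseteq> {..<n} \<times> {..<n}"
    by (auto simp: safe_links_def links_def)
  then have "card (safe_links n s f p) \<le> card ({..<n} \<times> {..<n})"
    by (intro card_mono) auto
  then show ?thesis
    by simp
qed

lemma div_mod_in_links: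
  assumes "n \<ge> 1" "q < n * n"
  shows "(q div n, q mod n) \<in> links n f \<longleftrightarrow> 0 < f q"
  using assms div_less_square[of q n] by (simp add: links_def)

lemma wp_Search:
  assumes n: "n \<ge> 1" and v: "ready n k v" "v ''p'' = p" "p < n * n" and a: "zero_one a"
    and Q: "\<And>v' r. ready n k v' \<Longrightarrow> v' ''p'' = p \<Longrightarrow> zero_one (a(''R'' := r)) \<Longrightarrow>
      (\<And>y. y < n \<Longrightarrow> 0 < r y \<longleftrightarrow> (p div n, y) \<in> (safe_links n (a ''S'') (a ''F'') p)\<^sup>*) \<Longrightarrow>
      Q v' (a(''R'' := r))"
  shows "wp n Search Q v a"
proof -
  let ?D = "safe_links n (a ''S'') (a ''F'') p"
  let ?u = "p div n"
  note bd = value_bound_simps[OF n]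
  have v': "v ''n'' = n" "v ''m'' = n * n"
    using v by (auto simp: ready_def)
  have u: "?u < n"
    using v by (simp add: div_less_square)
  \<comment> \<open>\<open>ok\<close> contains the soundness of the marking; \<open>reached\<close>
    is its completeness for walks of at most \<open>t\<close> links.\<close>
  define ok where "ok v' r \<longleftrightarrow> ready n k v' \<and> v' ''p'' = p \<and> (\<forall>y. r y \<le> Suc 0) \<and>
    (\<forall>y<n. 0 < r y \<longrightarrow> (?u, y) \<in> ?D\<^sup>*)" for v' :: "vname \<Rightarrow> nat" and r :: "nat \<Rightarrow> nat"
  define reached where "reached t r \<longleftrightarrow> (\<forall>j\<le>t. \<forall>y. (?u, y) \<in> ?D ^^ j \<longrightarrow> 0 < r y)"
    for t and r :: "nat \<Rightarrow> nat"
  have D: "x < n \<and> y < n" if "(x, y) \<in> ?D" for x y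
    using that by (auto simp: safe_links_def links_def)
  let ?g = "Conj (Pos (Arr ''F'' (Var ''q'')))
     (Conj (Conj (Safe (Var ''p'') (Fst (Var ''q''))) (Safe (Var ''p'') (Snd (Var ''q''))))
       (Pos (Arr ''R'' (Fst (Var ''q'')))))"
  let ?Sweep = "For ''q'' ''m'' (Cond ?g (Store ''R'' (Snd (Var ''q'')) (Const 1)) SKIP)"
  let ?I = "\<lambda>t v' a'. \<exists>r. a' = a(''R'' := r) \<and> ok v' r \<and> reached t r"
  have sweep: "wp n ?Sweep (\<lambda>v a. v ''t'' = t \<and> ?I (Suc t) (v(''t'' := Suc t)) a) w (a(''R'' := r0))"
    if w: "w ''t'' = t" "ok w r0" "reached t r0" for w r0 t
  proof -
    \<comment> \<open>Progress is measured against \<open>r0\<close>, the marking at the start of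
      the sweep. During the sweep \<open>R\<close> may already contain further discoveries, which
      does no harm because the marking only grows.\<close>
    let ?J = "\<lambda>i v' a'. v' ''t'' = t \<and> (\<exists>r. a' = a(''R'' := r) \<and> ok v' r \<and> (\<forall>y. r0 y \<le> r y) \<and>
      (\<forall>q<i. (q div n, q mod n) \<in> ?D \<longrightarrow> 0 < r0 (q div n) \<longrightarrow> 0 < r (q mod n)))"
    show ?thesis
    proof (rule wp_For[OF n loop_m, where I = ?J])
      show "?J 0 (w(''q'' := 0)) (a(''R'' := r0))"
        using w by (auto simp: ok_def ready_def)
    next
      fix i v' a' assume i: "i < n * n" "v' ''q'' = i" and J: "?J i v' a'"
      then obtain r where r: "a' = a(''R'' := r)" "ok v' r" "\<And>y. r0 y \<le> r y"
        "\<And>q. q < i \<Longrightarrow> (q div n, q mod n) \<in> ?D \<Longrightarrow> 0 < r0 (q div n) \<Longrightarrow> 0 < r (q mod n)"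
        by blast
      have vn: "v' ''n'' = n" "v' ''m'' = n * n" "v' ''p'' = p" "\<And>y. r y \<le> Suc 0"
        using r(2) by (auto simp: ok_def ready_def)
      have bin: "zero_one a'"
        unfolding r(1) using vn(4) by (intro zero_one_upd[OF a])
      have i_div: "i div n < n" "i mod n < n"
        using i n div_less_square[of i n] by auto
      have "bval ?g (mem v' a') \<longleftrightarrow> (i div n, i mod n) \<in> ?D \<and> 0 < r (i div n)"
        using i vn i_div v(3) r(1) div_mod_in_links[OF n, of i "a ''F''"]
        by (simp add: bval_Safe safe_links_def)
      moreover have "bbounded (value_bound n) (Safe (Var ''p'') (Fst (Var ''q''))) (mem v' a')"
        "bbounded (value_bound n) (Safe (Var ''p'') (Snd (Var ''q''))) (mem v' a')"
        using i vn i_div v(3) bd bin by (auto intro!: bounded_Safe[where v = v' and a = a'])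
      then have "bbounded (value_bound n) ?g (mem v' a')"
        using i vn i_div v(3) bd le_trans[OF zero_one_le[OF bin]] by auto
      ultimately show "wp n (Cond ?g (Store ''R'' (Snd (Var ''q'')) (Const 1)) SKIP)
          (\<lambda>v a. v ''q'' = i \<and> ?J (Suc i) (v(''q'' := Suc i)) a) v' a'"
      proof (intro wp_Cond wp_Store wp_SKIP)
        assume g: "bval ?g (mem v' a')" "bval ?g (mem v' a') \<longleftrightarrow> (i div n, i mod n) \<in> ?D \<and> 0 < r (i div n)"
        let ?r = "r(i mod n := 1)"
        have "(?u, i div n) \<in> ?D\<^sup>*"
          using g r(2) i_div by (auto simp: ok_def)
        then have "(?u, i mod n) \<in> ?D\<^sup>*"
          using g by (meson rtrancl.rtrancl_into_rtrancl)
        then have "ok (v'(''q'' := Suc i)) ?r"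
          using r(2) by (auto simp: ok_def ready_def)
        \<comment> \<open>Overwriting a cell with 1 cannot take it below \<open>r0\<close>, since
          \<open>ok\<close> bounds \<open>r0\<close> by 1.\<close>
        moreover have "r0 y \<le> ?r y" for y
          using r(3)[of y] w(2) by (auto simp: ok_def)
        moreover have "0 < ?r (q mod n)"
          if "q < Suc i" "(q div n, q mod n) \<in> ?D" "0 < r0 (q div n)" for q
          using r(4)[of q] that by (auto simp: less_Suc_eq)
        ultimately have "?J (Suc i) (v'(''q'' := Suc i)) (a(''R'' := ?r))"
          using J by (intro conjI exI[of _ ?r]) auto
        then show "v' ''q'' = i \<and> ?J (Suc i) (v'(''q'' := Suc i))
            (a'(''R'' := (a' ''R'')(aval (Snd (Var ''q'')) (mem v' a') := aval (Const 1) (mem v' a'))))"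
          using i vn r(1) by simp
      next
        assume g: "\<not> bval ?g (mem v' a')" "bval ?g (mem v' a') \<longleftrightarrow> (i div n, i mod n) \<in> ?D \<and> 0 < r (i div n)"
        have "0 < r (q mod n)"
          if "q < Suc i" "(q div n, q mod n) \<in> ?D" "0 < r0 (q div n)" for q
          using r(3)[of "q div n"] r(4)[of q] that g by (auto simp: less_Suc_eq)
        moreover have "ok (v'(''q'' := Suc i)) r"
          using r(2) by (auto simp: ok_def ready_def)
        ultimately have "?J (Suc i) (v'(''q'' := Suc i)) a'"
          using J r by (intro conjI exI[of _ r]) auto
        then show "v' ''q'' = i \<and> ?J (Suc i) (v'(''q'' := Suc i)) a'"
          using i by simp
      qed (use i vn bd in \<open>auto intro: less_imp_le less_le_trans\<close>)
    next
      fix v' a' assume "v' ''q'' = n * n" and J: "?J (n * n) v' a'"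
      then obtain r where r: "a' = a(''R'' := r)" "ok v' r" "\<And>y. r0 y \<le> r y"
        "\<And>q. q < n * n \<Longrightarrow> (q div n, q mod n) \<in> ?D \<Longrightarrow> 0 < r0 (q div n) \<Longrightarrow> 0 < r (q mod n)"
        by blast
      have "0 < r y" if j: "j \<le> Suc t" "(?u, y) \<in> ?D ^^ j" for j y
      proof (cases "j \<le> t")
        case True
        then have "0 < r0 y"
          using w(3) j unfolding reached_def by blast
        then show ?thesis
          using r(3)[of y] by simp
      next
        case False
        then have "(?u, y) \<in> ?D ^^ Suc t"
          using j by (simp add: le_Suc_eq)
        then obtain x where x: "(?u, x) \<in> ?D ^^ t" "(x, y) \<in> ?D"
          by auto
        then have "0 < r0 x"
          using w(3) unfolding reached_def by blast
        then show ?thesis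
          using r(4)[of "x * n + y"] index_less[of x n y] D[OF x(2)] x(2) by simp
      qed
      then have "reached (Suc t) r"
        by (auto simp: reached_def)
      then show "v' ''t'' = t \<and> ?I (Suc t) (v'(''t'' := Suc t)) a'"
        using J r by (auto simp: ok_def ready_def)
    qed (auto simp: ok_def ready_def)
  qed
  let ?r0 = "\<lambda>i. if i < n \<and> True then 0 else a ''R'' i"
  let ?r = "?r0(?u := 1)"
  have r0: "zero_one (a(''R'' := ?r0))"
    using zero_one_le[OF a] by (intro zero_one_upd[OF a]) auto
  have "wp n (For ''t'' ''m'' ?Sweep) Q (v(''x'' := n)) (a(''R'' := ?r))"
  proof (rule wp_For[OF n loop_m, where I = ?I])
    have "ok (v(''x'' := n, ''t'' := 0)) ?r"
      using v zero_one_le[OF a] by (auto simp: ok_def ready_def)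
    moreover have "reached 0 ?r"
      by (simp add: reached_def)
    ultimately show "?I 0 (v(''x'' := n, ''t'' := 0)) (a(''R'' := ?r))"
      by blast
  next
    fix t w b assume "w ''t'' = t" "?I t w b"
    then show "wp n ?Sweep (\<lambda>v a. v ''t'' = t \<and> ?I (Suc t) (v(''t'' := Suc t)) a) w b"
      using sweep by blast
  next
    fix w b assume "?I (n * n) w b"
    then obtain r where r: "b = a(''R'' := r)" "ok w r" "reached (n * n) r"
      by blast
    have "0 < r y" if reachable: "(?u, y) \<in> ?D\<^sup>*" for y
    proof -
      \<comment> \<open>A reachable vertex is reachable within \<open>card ?D\<close> links, which
        is at most the number \<open>n * n\<close> of rounds.\<close>
      obtain j where "(?u, y) \<in> ?D ^^ j" "j \<le> card ?D"
        using reachable unfolding rtrancl_finite_eq_relpow[OF finite_safe_links] by auto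
      then show ?thesis
        using r(3) card_safe_links[of n "a ''S''" "a ''F''" p] le_trans unfolding reached_def by blast
    qed
    moreover have "(?u, y) \<in> ?D\<^sup>*" if "y < n" "0 < r y" for y
      using r(2) that by (simp add: ok_def)
    ultimately show "Q w b"
      unfolding r(1)
    proof (intro Q zero_one_upd[OF a])
      show "ready n k w" "w ''p'' = p" "\<And>y. r y \<le> Suc 0"
        using r(2) by (simp_all add: ok_def)
    qed blast
  qed (auto simp: ok_def ready_def)
  then show ?thesis
    unfolding Search_def using v v' u bd
    by (intro wp_Seq wp_Mark[OF n loop_n, where P = "\<lambda>_. True"] wp_Store)
      (auto simp: zero_one_le[OF a] intro: less_imp_le less_le_trans)
qed

section \<open>Cliques on small safe sets\<close>

abbreviation safe_fun :: "nat \<Rightarrow> (nat \<Rightarrow> nat) \<Rightarrow> nat \<Rightarrow> nat \<Rightarrow> nat set" where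
  "safe_fun n s u v \<equiv> safe_at n s (u * n + v)"

text \<open>The number of edges that \<open>F\<close> shares with the current graph is the potential
  to which cliques are charged. Quantifying over all feasible \<open>F\<close> allows an optimal one
  to be chosen at the very end.\<close>

definition clique_phase ::
  "nat \<Rightarrow> nat \<Rightarrow> (nat \<Rightarrow> nat) \<Rightarrow> (nat \<Rightarrow> nat) \<Rightarrow> nat \<Rightarrow> (nat \<Rightarrow> nat) \<Rightarrow> bool" where
  "clique_phase n k s f0 i f \<longleftrightarrow> sym (links n f) \<and> links n f0 \<subseteq> links n f \<and>
     (\<forall>p<i. (p div n, p mod n) \<in> (safe_links n s f p)\<^sup>*) \<and>
     (\<forall>F. feasible {..<n} (complete_edges {..<n}) (safe_fun n s) F \<longrightarrow>
        card (undirected (links n f)) \<le>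
          card (undirected (links n f0)) + k ^ 2 * card (F \<inter> undirected (links n f)))"

lemma safe_links_mono:
  "links n f \<subseteq> links n g \<Longrightarrow> (safe_links n s f p)\<^sup>* \<subseteq> (safe_links n s g p)\<^sup>*"
  by (rule rtrancl_mono) (auto simp: safe_links_def)

text \<open>Every feasible subgraph contains a safe path for the pair \<open>p\<close>, and hence an edge of the new
  clique that has not been present before.\<close>

lemma clique_phase_add:
  assumes inv: "clique_phase n k s f0 p f" and n: "n \<ge> 1" "p < n * n"
    and ends: "p div n \<in> safe_at n s p" "p mod n \<in> safe_at n s p"
    and large: "k \<le> card (safe_at n s p) \<Longrightarrow> (p div n, p mod n) \<in> (safe_links n s f0 p)\<^sup>*"
    and disconnected: "(p div n, p mod n) \<notin> (safe_links n s f p)\<^sup>*"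
    and f': "links n f' = links n f \<union> safe_at n s p \<times> safe_at n s p"
  shows "clique_phase n k s f0 (Suc p) f'"
proof -
  let ?A = "safe_at n s p" and ?U = "\<lambda>f. undirected (links n f)"
  have fin_A: "finite ?A"
    by (rule finite_subset[OF safe_at_subset]) simp
  \<comment> \<open>A large safe set was served by the stars already, and additional links do not
    destroy reachability.\<close>
  have "\<not> k \<le> card ?A"
    using large disconnected safe_links_mono[of n f0 f s p] inv by (auto simp: clique_phase_def)
  then have "card ?A * card ?A \<le> k ^ 2"
    by (simp add: power2_eq_square mult_le_mono)
  then have card_A: "card (undirected (?A \<times> ?A)) \<le> k ^ 2"
    using card_undirected_le[of "?A \<times> ?A"] fin_A by (simp add: card_cartesian_product)
  have "card (?U f') \<le> card (?U f0) + k ^ 2 * card (F \<inter> ?U f')"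
    if F: "feasible {..<n} (complete_edges {..<n}) (safe_fun n s) F" for F
  proof -
    have "p div n \<in> {..<n}" "p mod n \<in> {..<n}"
      using n div_less_square[of p n] by auto
    then obtain q where "is_path F (p div n) q (p mod n)" "set q \<subseteq> ?A"
      using F unfolding feasible_def safely_connected_def by (metis div_mult_mod_eq)
    then obtain x y where xy: "{x, y} \<in> F" "x \<in> ?A" "y \<in> ?A" "(x, y) \<notin> links n f"
      using is_path_leaves disconnected unfolding safe_links_def by metis
    have "x \<noteq> y"
      using xy(1) F by (auto simp: feasible_def complete_edges_def doubleton_eq_iff)
    then have "{x, y} \<in> undirected (?A \<times> ?A)"
      using xy by (auto simp: undirected_def)
    \<comment> \<open>Since the links are symmetric, the absence of \<open>(x, y)\<close> excludes
      the undirected edge in either orientation.\<close>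
    moreover have "{x, y} \<notin> ?U f"
      using xy(4) inv by (auto simp: undirected_def clique_phase_def doubleton_eq_iff dest: symD)
    ultimately have "F \<inter> ?U f \<subset> F \<inter> ?U f'"
      using xy(1) by (auto simp: f' undirected_Un)
    then have "card (F \<inter> ?U f) + 1 \<le> card (F \<inter> ?U f')"
      using psubset_card_mono[of "F \<inter> ?U f'"] by (simp add: finite_undirected Suc_le_eq)
    then have "k ^ 2 * (card (F \<inter> ?U f) + 1) \<le> k ^ 2 * card (F \<inter> ?U f')"
      by (rule mult_le_mono2)
    moreover have "card (?U f') \<le> card (?U f) + card (undirected (?A \<times> ?A))"
      unfolding f' undirected_Un by (rule card_Un_le)
    moreover have "card (?U f) \<le> card (?U f0) + k ^ 2 * card (F \<inter> ?U f)"
      using inv F by (simp add: clique_phase_def)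
    ultimately show ?thesis
      using card_A by simp
  qed
  moreover have "(q div n, q mod n) \<in> (safe_links n s f' q)\<^sup>*" if "q < Suc p" for q
  proof (cases "q = p")
    case True
    then show ?thesis
      using ends by (intro r_into_rtrancl) (simp add: safe_links_def f')
  next
    case False
    then have "(q div n, q mod n) \<in> (safe_links n s f q)\<^sup>*"
      using inv that by (simp add: clique_phase_def)
    then show ?thesis
      using safe_links_mono[of n f f' s q] f' by blast
  qed
  moreover have "sym (links n f')" "links n f0 \<subseteq> links n f'"
    using inv by (auto simp: clique_phase_def f' sym_def)
  ultimately show ?thesis
    by (simp add: clique_phase_def)
qed

lemma clique_phase_skip:
  assumes "clique_phase n k s f0 p f" "(p div n, p mod n) \<in> (safe_links n s f p)\<^sup>*"
  shows "clique_phase n k s f0 (Suc p) f"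
  using assms by (auto simp: clique_phase_def less_Suc_eq)

lemma clique_phase_safely_connected:
  assumes "clique_phase n k s f0 (n * n) f"
    and ends: "\<And>u v. u < n \<Longrightarrow> v < n \<Longrightarrow> v \<in> safe_fun n s u v"
  shows "safely_connected {..<n} (safe_fun n s) (undirected (links n f))"
  unfolding safely_connected_def
proof (intro ballI)
  fix u v assume "u \<in> {..<n}" "v \<in> {..<n}"
  then have uv: "u < n" "v < n"
    by simp_all
  have "\<forall>p<n * n. (p div n, p mod n) \<in> (safe_links n s f p)\<^sup>*"
    using assms(1) by (simp add: clique_phase_def)
  from this[rule_format, OF index_less[OF uv]] have "(u, v) \<in> (safe_links n s f (u * n + v))\<^sup>*"
    using uv by simp
  then show "\<exists>p. is_path (undirected (links n f)) u p v \<and> set p \<subseteq> safe_fun n s u v"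
    unfolding safe_links_def using ends[OF uv] by (rule rtrancl_imp_is_path)
qed

text \<open>The star edges present on entry remain the reference point \<open>f0\<close>;
  \<open>large\<close> says that they already serve every large safe set.\<close>

lemma wp_Add_Cliques:
  assumes n: "n \<ge> 1" and v: "ready n k v" and a: "zero_one a" "sym (links n (a ''F''))"
    and ends: "\<And>p. p < n * n \<Longrightarrow> p div n \<in> safe_at n (a ''S'') p \<and> p mod n \<in> safe_at n (a ''S'') p"
    and large: "\<And>p. p < n * n \<Longrightarrow> k \<le> card (safe_at n (a ''S'') p) \<Longrightarrow>
      (p div n, p mod n) \<in> (safe_links n (a ''S'') (a ''F'') p)\<^sup>*"
    and Q: "\<And>v' a'. clique_phase n k (a ''S'') (a ''F'') (n * n) (a' ''F'') \<Longrightarrow> Q v' a'"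
  shows "wp n Add_Cliques Q v a"
proof -
  let ?I = "\<lambda>i v' a'. ready n k v' \<and> zero_one a' \<and> a' ''S'' = a ''S'' \<and>
    clique_phase n k (a ''S'') (a ''F'') i (a' ''F'')"
  note bd = value_bound_simps[OF n]
  show ?thesis
    unfolding Add_Cliques_def
  proof (rule wp_For[OF n loop_m, where I = ?I])
    show "?I 0 (v(''p'' := 0)) a"
      using v a by (auto simp: ready_def clique_phase_def)
  next
    fix p v' a' assume p: "p < n * n" "v' ''p'' = p" and I: "?I p v' a'"
    let ?g = "Conj (Safe (Var ''p'') (Fst (Var ''q''))) (Safe (Var ''p'') (Snd (Var ''q'')))"
    let ?post = "\<lambda>v a. v ''p'' = p \<and> ?I (Suc p) (v(''p'' := Suc p)) a"
    show "wp n (Seq Search (Cond (Pos (Arr ''R'' (Snd (Var ''p'')))) SKIP (Mark ''q'' ''m'' ?g ''F'' 1)))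
        ?post v' a'"
    proof (rule wp_Seq, rule wp_Search[OF n])
      fix w r assume w: "ready n k w" "w ''p'' = p" and bin: "zero_one (a'(''R'' := r))"
        and r: "\<And>y. y < n \<Longrightarrow> 0 < r y \<longleftrightarrow> (p div n, y) \<in> (safe_links n (a' ''S'') (a' ''F'') p)\<^sup>*"
      have w': "w ''n'' = n" "w ''m'' = n * n"
        using w by (auto simp: ready_def)
      have p_mod: "p div n < n" "p mod n < n"
        using n p div_less_square[of p n] by auto
      show "wp n (Cond (Pos (Arr ''R'' (Snd (Var ''p'')))) SKIP (Mark ''q'' ''m'' ?g ''F'' 1))
          ?post w (a'(''R'' := r))"
      proof (rule wp_Cond)
        show "bbounded (value_bound n) (Pos (Arr ''R'' (Snd (Var ''p'')))) (mem w (a'(''R'' := r)))"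
          using bd w w' p le_trans[OF zero_one_le[OF bin, of "''R''"]] by simp
      next
        assume "bval (Pos (Arr ''R'' (Snd (Var ''p'')))) (mem w (a'(''R'' := r)))"
        then have "(p div n, p mod n) \<in> (safe_links n (a ''S'') (a' ''F'') p)\<^sup>*"
          using w w' r[OF p_mod(2)] I by simp
        then show "wp n SKIP ?post w (a'(''R'' := r))"
          using I w bin by (intro wp_SKIP) (auto simp: ready_def intro: clique_phase_skip)
      next
        assume "\<not> bval (Pos (Arr ''R'' (Snd (Var ''p'')))) (mem w (a'(''R'' := r)))"
        then have disconnected: "(p div n, p mod n) \<notin> (safe_links n (a ''S'') (a' ''F'') p)\<^sup>*"
          using w w' r[OF p_mod(2)] I by simp
        let ?A = "safe_at n (a ''S'') p"
        let ?f = "\<lambda>q. if q < n * n \<and> q div n \<in> ?A \<and> q mod n \<in> ?A then 1 else (a'(''R'' := r)) ''F'' q"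
        have "links n ?f = links n (a' ''F'') \<union> ?A \<times> ?A"
          unfolding links_mark[of n "\<lambda>x y. x \<in> ?A \<and> y \<in> ?A"] by (auto simp: safe_at_def)
        then have "clique_phase n k (a ''S'') (a ''F'') (Suc p) ?f"
          using I n p ends large disconnected by (intro clique_phase_add[where f = "a' ''F''"]) auto
        moreover have bin': "zero_one (a'(''R'' := r, ''F'' := ?f))"
          using zero_one_le[OF bin, of "''F''"] by (intro zero_one_upd[OF bin]) auto
        ultimately have post: "?post (w(''q'' := n * n)) (a'(''R'' := r, ''F'' := ?f))"
          using I w by (auto simp: ready_def)
        show "wp n (Mark ''q'' ''m'' ?g ''F'' 1) ?post w (a'(''R'' := r))"
        proof (rule wp_Mark[OF n loop_m, where P = "\<lambda>q. q div n \<in> ?A \<and> q mod n \<in> ?A"])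
          fix i :: nat and f :: "nat \<Rightarrow> nat"
          assume i: "i < n * n"
          have i_div: "i div n < n" "i mod n < n"
            using i n div_less_square[of i n] by auto
          show "bval ?g (mem (w(''q'' := i)) (a'(''R'' := r, ''F'' := f))) \<longleftrightarrow> i div n \<in> ?A \<and> i mod n \<in> ?A"
            using i_div w w' p I by (simp add: bval_Safe)
          assume f: "\<And>j. f j \<le> 1"
          have bin_f: "zero_one (a'(''R'' := r, ''F'' := f))"
            using f by (intro zero_one_upd[OF bin]) simp
          have "bbounded (value_bound n) (Safe (Var ''p'') (Fst (Var ''q'')))
              (mem (w(''q'' := i)) (a'(''R'' := r, ''F'' := f)))"
            by (rule bounded_Safe[OF n _ bin_f]) (use i i_div w w' p bd in auto)
          moreover have "bbounded (value_bound n) (Safe (Var ''p'') (Snd (Var ''q'')))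
              (mem (w(''q'' := i)) (a'(''R'' := r, ''F'' := f)))"
            by (rule bounded_Safe[OF n _ bin_f]) (use i i_div w w' p bd in auto)
          ultimately show "bbounded (value_bound n) ?g (mem (w(''q'' := i)) (a'(''R'' := r, ''F'' := f)))"
            by simp
        next
          show "(a'(''R'' := r)) ''F'' i \<le> 1" for i
            using zero_one_le[OF bin, of "''F''" i] by simp
        qed (use w' post in auto)
      qed simp
    qed (use I p in auto)
  next
    fix v' a' assume "?I (n * n) v' a'"
    then show "Q v' a'"
      using Q by blast
  qed (auto simp: ready_def)
qed

text \<open>Both ends are linked to a centre \<open>w\<close> in the safe set, so the walk through
  \<open>w\<close> stays safe. \<open>w\<close> may be an end itself, as \<open>star n w\<close>
  contains the loop at \<open>w\<close>.\<close>

lemma star_phase_connects: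
  assumes phase: "star_phase n k (safe_at n s) f h" "uncovered n h = {}"
    and p: "p < n * n" "k \<le> card (safe_at n s p)"
    and ends: "p div n \<in> safe_at n s p" "p mod n \<in> safe_at n s p"
  shows "(p div n, p mod n) \<in> (safe_links n s f p)\<^sup>*"
proof -
  have "h p \<noteq> 0"
    using phase(2) p(1) by (auto simp: uncovered_def)
  then obtain w where w: "w \<in> safe_at n s p" "star n w \<subseteq> links n f"
    using phase(1) p by (auto simp: star_phase_def)
  then have "(p div n, w) \<in> star n w" "(w, p mod n) \<in> star n w"
    using ends by (auto simp: star_def safe_at_def)
  then have "(p div n, w) \<in> safe_links n s f p" "(w, p mod n) \<in> safe_links n s f p"
    using w ends by (auto simp: safe_links_def)
  then show ?thesis
    by (meson r_into_rtrancl rtrancl.rtrancl_into_rtrancl)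
qed

section \<open>The whole program and its approximation ratio\<close>

lemma wp_Connect:
  assumes n: "n \<ge> 1" and v: "v ''n'' = n" "v ''k'' = 0" and a: "zero_one a"
    and zero: "a ''F'' = (\<lambda>_. 0)" "a ''H'' = (\<lambda>_. 0)"
    and ends: "\<And>p. p < n * n \<Longrightarrow> p div n \<in> safe_at n (a ''S'') p \<and> p mod n \<in> safe_at n (a ''S'') p"
    and Q: "\<And>v' a' k f h. \<lbrakk>k \<le> n; n \<le> k ^ 3; k = 0 \<or> (k - 1) ^ 3 < n;
      star_phase n k (safe_at n (a ''S'')) f h;
      clique_phase n k (a ''S'') f (n * n) (a' ''F'')\<rbrakk> \<Longrightarrow> Q v' a'"
  shows "wp n Connect Q v a"
  unfolding Connect_def
proof (rule wp_Seq, rule wp_Assign)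
  let ?v = "v(''m'' := n * n)"
  have "wp n (Seq Threshold (Seq Exclude_Small (Seq Add_Stars Add_Cliques))) Q ?v a"
  proof (rule wp_Seq, rule wp_Threshold[OF n])
    fix k v assume k: "k \<le> n" "n \<le> k ^ 3" "k = 0 \<or> (k - 1) ^ 3 < n" and v: "ready n k v"
    have "k \<ge> 1"
      using n k(2) by (cases k) auto
    show "wp n (Seq Exclude_Small (Seq Add_Stars Add_Cliques)) Q v a"
    proof (rule wp_Seq, rule wp_Exclude_Small[OF n k(1) v a zero(2)])
      fix w
      let ?a = "a(''H'' := (\<lambda>p. of_bool (p < n * n \<and> card (safe_at n (a ''S'') p) < k)))"
      assume w: "ready n k w"
      have "star_phase n k (safe_at n (?a ''S'')) (?a ''F'') (?a ''H'')"
        using star_phase_init[of n k "safe_at n (a ''S'')"] zero by simp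
      moreover have "zero_one ?a"
        by (rule zero_one_upd[OF a]) simp
      ultimately show "wp n (Seq Add_Stars Add_Cliques) Q w ?a"
      proof (intro wp_Seq wp_Add_Stars[OF n k(1) \<open>k \<ge> 1\<close> w])
        fix v' a' f h
        assume a': "a' = ?a(''F'' := f, ''H'' := h)" and v': "ready n k v'" "zero_one a'"
          and phase: "star_phase n k (safe_at n (?a ''S'')) f h" "uncovered n h = {}"
        have S: "a' ''S'' = a ''S''" "a' ''F'' = f"
          by (simp_all add: a')
        have phase': "star_phase n k (safe_at n (a ''S'')) f h"
          using phase by simp
        show "wp n Add_Cliques Q v' a'"
        proof (rule wp_Add_Cliques[OF n v'])
          show "sym (links n (a' ''F''))"
            using phase' by (simp add: star_phase_def S)
          show "p div n \<in> safe_at n (a' ''S'') p \<and> p mod n \<in> safe_at n (a' ''S'') p" if "p < n * n" for p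
            using ends[OF that] S by simp
          show "(p div n, p mod n) \<in> (safe_links n (a' ''S'') (a' ''F'') p)\<^sup>*"
            if "p < n * n" "k \<le> card (safe_at n (a' ''S'') p)" for p
            unfolding S using star_phase_connects[OF phase' phase(2)] that S ends by simp
          show "Q v'' a''" if "clique_phase n k (a' ''S'') (a' ''F'') (n * n) (a'' ''F'')" for v'' a''
            using Q[OF k phase'] that S by simp
        qed
      qed
    qed
  qed (use v in auto)
  then show "wp n (Seq Threshold (Seq Exclude_Small (Seq Add_Stars Add_Cliques))) Q
      (v(''m'' := aval (Times (Var ''n'') (Var ''n'')) (mem v a))) a"
    using v by simp
qed (use v value_bound_simps[OF n] in auto)

text \<open>The output format reads only cells above the diagonal; by symmetry they determine all
  edges.\<close>

lemma output_edges_eq: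
  assumes "sym (links n (arr s ''F''))"
  shows "output_edges n s = undirected (links n (arr s ''F''))"
proof (intro equalityI subsetI)
  fix e assume "e \<in> output_edges n s"
  then show "e \<in> undirected (links n (arr s ''F''))"
    by (fastforce simp: output_edges_def undirected_def links_def)
next
  fix e assume "e \<in> undirected (links n (arr s ''F''))"
  then obtain x y where e: "e = {x, y}" "(x, y) \<in> links n (arr s ''F'')" "x \<noteq> y"
    by (auto simp: undirected_def)
  moreover have "(y, x) \<in> links n (arr s ''F'')"
    using e assms by (auto dest: symD)
  moreover have "{u, v} \<in> output_edges n s" if "(u, v) \<in> links n (arr s ''F'')" "u < v" for u v
  proof -
    have "v < n" "arr s ''F'' (u * n + v) \<noteq> 0"
      using that by (auto simp: links_def)
    then show ?thesis
      unfolding output_edges_def using that(2) by blast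
  qed
  ultimately show "e \<in> output_edges n s"
    by (metis insert_commute linorder_neqE_nat)
qed

text \<open>This is the bound on \<open>2 * j + k^2\<close> for \<open>j\<close> stars, with
  \<open>j\<close> at most \<open>1 + 2 * n^(2/3) * ln n\<close> and \<open>k^2\<close> at most
  \<open>4 * n^(2/3)\<close>.\<close>

definition approx_factor :: "nat \<Rightarrow> real" where
  "approx_factor n = 2 + 4 * real n powr (2 / 3) * ln (real n) + 4 * real n powr (2 / 3)"

lemma approx_solution_of_phases:
  assumes n: "n \<ge> 1" and k: "k \<le> n" "n \<le> k ^ 3" "k = 0 \<or> (k - 1) ^ 3 < n"
    and stars: "star_phase n k A f0 h"
    and cliques: "clique_phase n k s f0 (n * n) f"
    and ends: "\<And>u v. u < n \<Longrightarrow> v < n \<Longrightarrow> v \<in> safe_fun n s u v"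
  shows "approx_solution (approx_factor n) {..<n} (complete_edges {..<n}) (safe_fun n s)
    (undirected (links n f))"
proof -
  let ?E = "complete_edges {..<n}" and ?G = "undirected (links n f)"
  have "?G \<subseteq> ?E"
    by (auto simp: undirected_def links_def complete_edges_def)
  then have feas: "feasible {..<n} ?E (safe_fun n s) ?G"
    using clique_phase_safely_connected[OF cliques ends] by (simp add: feasible_def)
  have "?E \<subseteq> Pow {..<n}"
    by (auto simp: complete_edges_def)
  then have "finite ?E"
    by (rule finite_subset) simp
  from opt_sum_attained[OF this feas] obtain F where
    F: "feasible {..<n} ?E (safe_fun n s) F" "card F = opt_sum {..<n} ?E (safe_fun n s)" .
  have "finite F"
    using F(1) \<open>finite ?E\<close> by (auto simp: feasible_def intro: finite_subset)
  have "real (card ?G) \<le> approx_factor n * real (card F)"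
  proof (cases "n = 1")
    case True
    \<comment> \<open>For a single vertex the lower bound \<open>n / 2\<close> on the optimum fails,
      but there are no edges at all.\<close>
    then have "?E = {}"
      by (auto simp: complete_edges_def)
    then show ?thesis
      using \<open>?G \<subseteq> ?E\<close> True by (simp add: approx_factor_def)
  next
    case False
    then have "n \<le> 2 * card F"
      using n F(1) by (intro card_vertices_le) auto
    obtain j where j: "card (undirected (links n f0)) \<le> n * j"
      "j = 0 \<or> 1 \<le> real n ^ 2 * (1 - real k / real n) ^ (j - 1)"
      using stars by (auto simp: star_phase_def)
    have "card ?G \<le> card (undirected (links n f0)) + k ^ 2 * card (F \<inter> ?G)"
      using cliques F(1) by (simp add: clique_phase_def)
    also have "\<dots> \<le> n * j + k ^ 2 * card F"
      using j(1) \<open>finite F\<close> by (intro add_mono mult_le_mono2 card_mono) auto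
    \<comment> \<open>The lower bound on the optimum turns the number of star edges into a multiple
      of it.\<close>
    also have "\<dots> \<le> 2 * card F * j + k ^ 2 * card F"
      using \<open>n \<le> 2 * card F\<close> by simp
    also have "\<dots> = (2 * j + k ^ 2) * card F"
      by (simp add: algebra_simps)
    finally have "real (card ?G) \<le> (2 * real j + real (k ^ 2)) * real (card F)"
      by (metis of_nat_add of_nat_le_iff of_nat_mult of_nat_numeral)
    also have "\<dots> \<le> approx_factor n * real (card F)"
      using greedy_rounds_le[OF n k(2,1) j(2)] square_threshold_le[OF n k(3)]
      by (intro mult_right_mono) (auto simp: approx_factor_def)
    finally show ?thesis .
  qed
  then show ?thesis
    using feas F(2) by (simp add: approx_solution_def)
qed

text \<open>The safe sets read from the input array agree with the given ones on vertices only;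
  feasibility, and with it the optimum, depends on nothing else.\<close>

lemma approx_solution_cong:
  assumes "\<And>u v. u \<in> V \<Longrightarrow> v \<in> V \<Longrightarrow> S u v = S' u v"
  shows "approx_solution \<alpha> V E S F \<longleftrightarrow> approx_solution \<alpha> V E S' F"
proof -
  have "feasible V E S = feasible V E S'"
    using assms by (auto simp: fun_eq_iff feasible_def safely_connected_def)
  then show ?thesis
    by (simp add: approx_solution_def opt_sum_def)
qed

lemma run_Connect:
  assumes n: "n \<ge> 1" and S: "safe_sets {..<n} S"
  obtains s where "run Connect (input_config n S) = return_spmf s"
    "approx_solution (approx_factor n) {..<n} (complete_edges {..<n}) S (output_edges n s)"
    "time s \<le> steps n Connect * step_cost n"
proof -
  let ?c = "input_config n S"
  let ?s = "arr ?c ''S''"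
  have safe: "safe_at n ?s p = S (p div n) (p mod n)" if p: "p < n * n" for p
  proof -
    have "p div n < n" "p mod n < n"
      using n p div_less_square[of p n] by auto
    then have sub: "S (p div n) (p mod n) \<subseteq> {..<n}"
      using S by (auto simp: safe_sets_def)
    \<comment> \<open>The input array is zero from \<open>n ^ 3\<close> on, so the index has to be
      in range for the cell to reflect \<open>S\<close>.\<close>
    have "p * n + w < n ^ 3" if "w < n" for w
    proof -
      have "p * n + w < Suc p * n"
        using that by simp
      also have "\<dots> \<le> n * n * n"
        using p by (intro mult_le_mono1) simp
      finally show ?thesis
        by (simp add: power3_eq_cube)
    qed
    then show ?thesis
      using sub by (auto simp: safe_at_def input_config_def)
  qed
  have ends: "p div n \<in> safe_at n ?s p \<and> p mod n \<in> safe_at n ?s p" if "p < n * n" for p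
    using S n that div_less_square[of p n] by (auto simp: safe safe_sets_def)
  have safe': "safe_fun n ?s u v = S u v" if "u < n" "v < n" for u v
    using safe[OF index_less[OF that]] that by simp
  define Q where "Q = (\<lambda>(v :: vname \<Rightarrow> nat) a. \<exists>k f h. k \<le> n \<and> n \<le> k ^ 3 \<and> (k = 0 \<or> (k - 1) ^ 3 < n) \<and>
    star_phase n k (safe_at n ?s) f h \<and> clique_phase n k ?s f (n * n) (a ''F''))"
  have "wp n Connect Q (var ?c) (arr ?c)"
  proof (rule wp_Connect[OF n])
    show "zero_one (arr ?c)"
      by (auto simp: zero_one_def input_config_def)
  next
    show "Q v' a'" if "k \<le> n" "n \<le> k ^ 3" "k = 0 \<or> (k - 1) ^ 3 < n"
      "star_phase n k (safe_at n ?s) f h" "clique_phase n k ?s f (n * n) (a' ''F'')" for v' a' k f h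
      unfolding Q_def using that by blast
  qed (use ends in \<open>auto simp: input_config_def\<close>)
  then obtain s where s: "run Connect ?c = return_spmf s" "Q (var s) (arr s)"
    "time s \<le> time ?c + steps n Connect * step_cost n"
    unfolding wp_def by blast
  then obtain k f h where kfh: "k \<le> n" "n \<le> k ^ 3" "k = 0 \<or> (k - 1) ^ 3 < n"
    "star_phase n k (safe_at n ?s) f h" "clique_phase n k ?s f (n * n) (arr s ''F'')"
    unfolding Q_def by blast
  have "approx_solution (approx_factor n) {..<n} (complete_edges {..<n}) (safe_fun n ?s)
      (undirected (links n (arr s ''F'')))"
    using S by (intro approx_solution_of_phases[OF n kfh]) (auto simp: safe' safe_sets_def)
  moreover have "output_edges n s = undirected (links n (arr s ''F''))"
    using kfh(5) by (intro output_edges_eq) (simp add: clique_phase_def)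
  ultimately have "approx_solution (approx_factor n) {..<n} (complete_edges {..<n}) S (output_edges n s)"
    using approx_solution_cong[of "{..<n}" "safe_fun n ?s" S] safe' by simp
  then show ?thesis
    using that s by (simp add: input_config_def)
qed

section \<open>Asymptotic bounds\<close>

lemma soft_O_approx_factor: "approx_factor \<in> soft_O (\<lambda>n. real n powr (2 / 3))"
proof -
  have "(\<lambda>n. 2 + 4 * real n powr (2 / 3) * ln (real n) + 4 * real n powr (2 / 3))
      \<in> O(\<lambda>n. real n powr (2 / 3) * ln (real n) ^ 1)"
    by real_asymp
  then show ?thesis
    unfolding soft_O_def approx_factor_def[abs_def] by blast
qed

text \<open>The 2 collects the successor in \<open>bits\<close> and the one in
  \<open>floorlog\<close>.\<close>

lemma bits_le_ln:
  assumes "k \<ge> 1"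
  shows "real (bits k) \<le> 2 + ln (real k) / ln 2"
proof -
  have "0 \<le> log 2 (real k)"
    using assms by simp
  then have "real (nat \<lfloor>log 2 (real k)\<rfloor>) \<le> log 2 (real k)"
    by linarith
  then show ?thesis
    using assms by (simp add: bits_def floorlog_def log_def nat_add_distrib)
qed

lemma steps_simps [simp]:
  "steps n (For x b c) = 2 + (if b = ''m'' then n * n else n) * (2 + steps n c)"
  "steps n (Count x b g) = 3 + (if b = ''m'' then n * n else n) * 5"
  "steps n (Mark x b g A k) = 2 + (if b = ''m'' then n * n else n) * 5"
  by (simp_all add: For_def Count_def Mark_def iterations_def)

text \<open>The term \<open>5*n^6\<close> stems from the search for every pair, \<open>5*n^5\<close>
  from the greedy choice with \<open>n^2\<close> rounds, \<open>n\<close> candidates and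
  \<open>n^2\<close> pairs. The 5 is the charge for one round of an innermost loop: loop test,
  increment, condition and both branches.\<close>

lemma steps_Connect: "steps n Connect = 9 + 5*n + 31*n^2 + 19*n^3 + 19*n^4 + 5*n^5 + 5*n^6"
  unfolding Connect_def Threshold_def Exclude_Small_def Most_Frequent_def Add_Star_def Add_Stars_def
    Search_def Add_Cliques_def
  by (simp add: algebra_simps eval_nat_numeral)

lemma steps_Connect_bigo: "(\<lambda>n. real (steps n Connect)) \<in> O(\<lambda>n. real n ^ 6)"
  unfolding steps_Connect of_nat_add of_nat_mult of_nat_power of_nat_numeral by real_asymp

text \<open>Values up to \<open>2 * n^3\<close> have bit lengths of order \<open>ln n\<close>; the
  square accounts for products and quotients.\<close>

lemma step_cost_bigo: "(\<lambda>n. real (step_cost n)) \<in> O(\<lambda>n. ln (real n) ^ 2)"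
proof -
  have "(\<lambda>n. real (step_cost n)) \<in> O(\<lambda>n. 100 * (2 + ln (real (2 * n ^ 3)) / ln 2) ^ 2)"
  proof (rule landau_o.big_mono, rule eventually_mono[OF eventually_ge_at_top[of 1]])
    fix n :: nat assume "n \<ge> 1"
    then have "1 \<le> value_bound n"
      using value_bound_simps(1) by simp
    then have "real (bits (value_bound n)) \<le> 2 + ln (real (2 * n ^ 3)) / ln 2"
      using bits_le_ln[of "value_bound n"] by (simp add: value_bound_def)
    then have "real (bits (value_bound n)) ^ 2 \<le> (2 + ln (real (2 * n ^ 3)) / ln 2) ^ 2"
      by (intro power_mono) auto
    then show "norm (real (step_cost n)) \<le> norm (100 * (2 + ln (real (2 * n ^ 3)) / ln 2) ^ 2)"
      by (simp add: step_cost_def)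
  qed
  also have "(\<lambda>n. 100 * (2 + ln (real (2 * n ^ 3)) / ln 2) ^ 2) \<in> O(\<lambda>n. ln (real n) ^ 2)"
    by simp real_asymp
  finally show ?thesis .
qed

theorem theorem9:
  fixes c :: nat
  shows "\<exists>(prog :: com) (\<alpha> :: nat \<Rightarrow> real) (T :: nat \<Rightarrow> real).
    \<alpha> \<in> soft_O (\<lambda>n. real n powr (2 / 3)) \<and>
    T \<in> soft_O (\<lambda>n. real n ^ 6) \<and>
    (\<forall>n\<ge>1. \<forall>S :: nat \<Rightarrow> nat \<Rightarrow> nat set. safe_sets {..<n} S \<longrightarrow>
      runs_within prog (input_config n S) (T n) \<and>
      measure (measure_spmf (run prog (input_config n S)))
        {s. approx_solution (\<alpha> n) {..<n} (complete_edges {..<n}) S (output_edges n s)}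
      \<ge> 1 - 1 / real n ^ c)"
proof (intro exI conjI allI impI)
  show "approx_factor \<in> soft_O (\<lambda>n. real n powr (2 / 3))"
    by (rule soft_O_approx_factor)
  show "(\<lambda>n. real (steps n Connect) * real (step_cost n)) \<in> soft_O (\<lambda>n. real n ^ 6)"
    unfolding soft_O_def using landau_o.big.mult[OF steps_Connect_bigo step_cost_bigo] by blast
next
  fix n :: nat and S :: "nat \<Rightarrow> nat \<Rightarrow> nat set"
  assume "n \<ge> 1" "safe_sets {..<n} S"
  then obtain s where s: "run Connect (input_config n S) = return_spmf s"
    "approx_solution (approx_factor n) {..<n} (complete_edges {..<n}) S (output_edges n s)"
    "time s \<le> steps n Connect * step_cost n"
    by (rule run_Connect)
  show "runs_within Connect (input_config n S) (real (steps n Connect) * real (step_cost n))"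
    using s(3) unfolding runs_within_def s(1) by (simp flip: of_nat_mult)
  \<comment> \<open>The run is a point distribution on a good outcome, so the probability is 1,
    whatever \<open>c\<close> is.\<close>
  show "measure (measure_spmf (run Connect (input_config n S)))
      {s. approx_solution (approx_factor n) {..<n} (complete_edges {..<n}) S (output_edges n s)}
      \<ge> 1 - 1 / real n ^ c"
    using s(2) unfolding s(1) by (simp add: measure_spmf_return_spmf measure_return)
qed

end
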